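(* Let $\varphi\in\mathcal{A}=\mathbf{F}[x,y,z]$ be a weight homogeneous polynomial with an isolated singularity, and let $\{\cdot,\cdot\}_\varphi$ be the Poisson bracket on $\mathcal{A}$ determined by $\{x,y\}_\varphi=\frac{\partial\varphi}{\partial z}$, $\{y,z\}_\varphi=\frac{\partial\varphi}{\partial x}$, $\{z,x\}_\varphi=\frac{\partial\varphi}{\partial y}$. Then every formal deformation of $\{\cdot,\cdot\}_\varphi$ admits a formal Casimir.
   Context: $\mathbf{F}$ is a field of characteristic zero. A polynomial $\varphi\in\mathbf{F}[x,y,z]$ is weight homogeneous of weighted degree $\varpi(\varphi)\in\mathbf{N}$ if there are positive integers $\varpi_1,\varpi_2,\varpi_3$ without common divisor (the weights of $x,y,z$) with $\varpi_1x\frac{\partial\varphi}{\partial x}+\varpi_2y\frac{\partial\varphi}{\partial y}+\varpi_3z\frac{\partial\varphi}{\partial z}=\varpi(\varphi)\varphi$. It has an isolated singularity (at the origin) if $\mathcal{A}_{sing}(\varphi)=\mathbf{F}[x,y,z]/\langle\frac{\partial\varphi}{\partial x},\frac{\partial\varphi}{\partial y},\frac{\partial\varphi}{\partial z}\rangle$ is finite-dimensional over $\mathbf{F}$, of dimension $\mu\ge1$. A formal deformation of a Poisson structure $\pi_0$ on $\mathcal{A}$ is a map $\pi_*=\pi_0+\pi_1\nu+\pi_2\nu^2+\cdots:\mathcal{A}[[\nu]]\times\mathcal{A}[[\nu]]\to\mathcal{A}[[\nu]]$, where each $\pi_i:\mathcal{A}\times\mathcal{A}\to\mathcal{A}$ is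 a skew-symmetric biderivation (extended $\mathbf{F}[[\nu]]$-bilinearly), which satisfies the Jacobi identity. A formal Casimir of $\pi_*$ is an element $C\in\mathcal{A}[[\nu]]$ in the center of $\pi_*$, i.e. with $\pi_*[C,F]=0$ for all $F\in\mathcal{A}[[\nu]]$. *)

theory Defs
  imports "HOL-Computational_Algebra.Computational_Algebra"
begin

text \<open>
  The algebra \<open>\<A> = F[x,y,z]\<close> is rendered as the iterated polynomial ring \<open>F[x][y][z]\<close>: the
  outermost polynomial layer carries \<open>z\<close>, the innermost one \<open>x\<close>.
\<close>

type_synonym 'a poly3 = "'a poly poly poly"

definition const3 :: "'a::field_char_0 \<Rightarrow> 'a poly3" where
  "const3 c = [:[:[:c:]:]:]"

definition var_x :: "'a::field_char_0 poly3" where "var_x = [:[:[:0, 1:]:]:]"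
definition var_y :: "'a::field_char_0 poly3" where "var_y = [:[:0, 1:]:]"
definition var_z :: "'a::field_char_0 poly3" where "var_z = [:0, 1:]"

definition diff_x :: "'a::field_char_0 poly3 \<Rightarrow> 'a poly3" where
  "diff_x = map_poly (map_poly pderiv)"
definition diff_y :: "'a::field_char_0 poly3 \<Rightarrow> 'a poly3" where
  "diff_y = map_poly pderiv"
definition diff_z :: "'a::field_char_0 poly3 \<Rightarrow> 'a poly3" where
  "diff_z = pderiv"

definition weight_homogeneous :: "'a::field_char_0 poly3 \<Rightarrow> bool" where
  "weight_homogeneous \<phi> \<longleftrightarrow>
     (\<exists>w1 w2 w3 d :: nat. w1 > 0 \<and> w2 > 0 \<and> w3 > 0 \<and> gcd w1 (gcd w2 w3) = 1 \<and>
        of_nat w1 * var_x * diff_x \<phi> + of_nat w2 * var_y * diff_y \<phi>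
          + of_nat w3 * var_z * diff_z \<phi> = of_nat d * \<phi>)"

definition jacobian_ideal :: "'a::field_char_0 poly3 \<Rightarrow> 'a poly3 set" where
  "jacobian_ideal \<phi> = {a * diff_x \<phi> + b * diff_y \<phi> + c * diff_z \<phi> | a b c. True}"

text \<open>
  A basis of the \<open>F\<close>-vector space \<open>\<A>/J\<close> is given by representatives: a finite set \<open>B\<close> such that
  each \<open>p\<close> is congruent modulo \<open>J\<close> to exactly one \<open>F\<close>-linear combination of \<open>B\<close>. Uniqueness
  makes the classes of the elements of \<open>B\<close> distinct, so that \<open>card B\<close> is the dimension.
\<close>

definition quotient_basis :: "'a::field_char_0 poly3 set \<Rightarrow> 'a poly3 set \<Rightarrow> bool" where
  "quotient_basis J B \<longleftrightarrow> finite B \<and>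
     (\<forall>p. \<exists>!c. (\<forall>b. b \<notin> B \<longrightarrow> c b = 0) \<and> p - (\<Sum>b\<in>B. const3 (c b) * b) \<in> J)"

definition quotient_has_dim :: "'a::field_char_0 poly3 set \<Rightarrow> nat \<Rightarrow> bool" where
  "quotient_has_dim J m \<longleftrightarrow> (\<exists>B. quotient_basis J B \<and> card B = m)"

definition isolated_singularity :: "'a::field_char_0 poly3 \<Rightarrow> bool" where
  "isolated_singularity \<phi> \<longleftrightarrow> (\<exists>\<mu>\<ge>1. quotient_has_dim (jacobian_ideal \<phi>) \<mu>)"

definition is_derivation :: "('a::field_char_0 poly3 \<Rightarrow> 'a poly3) \<Rightarrow> bool" where
  "is_derivation D \<longleftrightarrow>
     (\<forall>p q. D (p + q) = D p + D q) \<and>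
     (\<forall>c p. D (const3 c * p) = const3 c * D p) \<and>
     (\<forall>p q. D (p * q) = p * D q + q * D p)"

definition skew_biderivation :: "('a::field_char_0 poly3 \<Rightarrow> 'a poly3 \<Rightarrow> 'a poly3) \<Rightarrow> bool" where
  "skew_biderivation P \<longleftrightarrow>
     (\<forall>p q. P p q = - P q p) \<and>
     (\<forall>q. is_derivation (\<lambda>p. P p q)) \<and> (\<forall>p. is_derivation (\<lambda>q. P p q))"

text \<open>
  The lemmas following this definition show that it is the skew-symmetric biderivation with the
  prescribed values on the generators, that it is the only one, and that it is a Poisson bracket.
\<close>

definition poisson_bracket ::
    "'a::field_char_0 poly3 \<Rightarrow> 'a poly3 \<Rightarrow> 'a poly3 \<Rightarrow> 'a poly3" where
  "poisson_bracket \<phi> p q =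
     diff_x \<phi> * (diff_y p * diff_z q - diff_z p * diff_y q) +
     diff_y \<phi> * (diff_z p * diff_x q - diff_x p * diff_z q) +
     diff_z \<phi> * (diff_x p * diff_y q - diff_y p * diff_x q)"

lemma diff_var [simp]:
  "diff_x var_x = 1" "diff_x var_y = 0" "diff_x var_z = 0"
  "diff_y var_x = 0" "diff_y var_y = 1" "diff_y var_z = 0"
  "diff_z var_x = 0" "diff_z var_y = 0" "diff_z var_z = 1"
  by (simp_all add: diff_x_def diff_y_def diff_z_def var_x_def var_y_def var_z_def
      map_poly_pCons pderiv_pCons one_pCons)

lemma poisson_bracket_generators:
  "poisson_bracket \<phi> var_x var_y = diff_z \<phi>"
  "poisson_bracket \<phi> var_y var_z = diff_x \<phi>"
  "poisson_bracket \<phi> var_z var_x = diff_y \<phi>"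
  by (simp_all add: poisson_bracket_def)

lemma map_poly_additive:
  assumes "\<And>a b. f (a + b) = f a + f b" "f 0 = (0::'b::comm_monoid_add)"
  shows "map_poly f (p + q) = map_poly f p + map_poly f q"
  by (rule poly_eqI) (simp add: coeff_map_poly assms)

lemma map_poly_leibniz:
  fixes f :: "'b::comm_ring_1 \<Rightarrow> 'b"
  assumes add: "\<And>a b. f (a + b) = f a + f b" and "f 0 = 0"
    and leib: "\<And>a b. f (a * b) = a * f b + b * f a"
  shows "map_poly f (p * q) = p * map_poly f q + q * map_poly f p"
proof (rule poly_eqI)
  fix n
  have sum: "f (sum g S) = (\<Sum>i\<in>S. f (g i))" for g and S :: "nat set"
    by (induction S rule: infinite_finite_induct) (simp_all add: add assms(2))
  have swap: "q * map_poly f p = map_poly f p * q" by (rule mult.commute)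
  show "coeff (map_poly f (p * q)) n = coeff (p * map_poly f q + q * map_poly f p) n"
    unfolding swap
    by (simp add: coeff_map_poly assms(2) coeff_mult sum leib sum.distrib mult.commute[of _ "f _"])
qed

lemma diff_add:
  "diff_x (p + q) = diff_x p + diff_x q"
  "diff_y (p + q) = diff_y p + diff_y q"
  "diff_z (p + q) = diff_z p + diff_z q"
  by (simp_all add: diff_x_def diff_y_def diff_z_def map_poly_additive pderiv_add)

lemma diff_mult:
  "diff_x (p * q) = p * diff_x q + q * diff_x p"
  "diff_y (p * q) = p * diff_y q + q * diff_y p"
  "diff_z (p * q) = p * diff_z q + q * diff_z p"
  by (simp_all add: diff_x_def diff_y_def diff_z_def map_poly_leibniz map_poly_additive
      pderiv_add pderiv_mult)

lemma diff_const3 [simp]: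
  "diff_x (const3 c) = 0" "diff_y (const3 c) = 0" "diff_z (const3 c) = 0"
  by (simp_all add: diff_x_def diff_y_def diff_z_def const3_def map_poly_pCons pderiv_pCons)

lemma skew_biderivation_poisson_bracket: "skew_biderivation (poisson_bracket \<phi>)"
  unfolding skew_biderivation_def is_derivation_def poisson_bracket_def
  by (auto simp: diff_add diff_mult algebra_simps)

lemma diff_minus:
  "diff_x (- p) = - diff_x p" "diff_y (- p) = - diff_y p" "diff_z (- p) = - diff_z p"
proof -
  have "p + - p = const3 0" by (simp add: const3_def)
  then show "diff_x (- p) = - diff_x p" "diff_y (- p) = - diff_y p" "diff_z (- p) = - diff_z p"
    using diff_add[of p "- p"] by (metis diff_const3 minus_unique)+
qed

lemma diff_diff:
  "diff_x (p - q) = diff_x p - diff_x q"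
  "diff_y (p - q) = diff_y p - diff_y q"
  "diff_z (p - q) = diff_z p - diff_z q"
  using diff_add[of p "- q"] by (simp_all add: diff_minus)

lemma pderiv_map_poly:
  fixes f :: "'b::{comm_ring_1,semiring_no_zero_divisors} \<Rightarrow> 'b"
  assumes add: "\<And>a b. f (a + b) = f a + f b" and "f 0 = 0"
  shows "pderiv (map_poly f p) = map_poly f (pderiv p)"
proof (rule poly_eqI)
  fix n
  have "f (of_nat k * a) = of_nat k * f a" for k a
    by (induction k) (simp_all add: assms algebra_simps)
  from this[of "Suc n"]
  show "coeff (pderiv (map_poly f p)) n = coeff (map_poly f (pderiv p)) n"
    by (simp add: coeff_pderiv coeff_map_poly assms(2))
qed

lemma diff_commute:
  "diff_y (diff_x p) = diff_x (diff_y p)"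
  "diff_z (diff_x p) = diff_x (diff_z p)"
  "diff_z (diff_y p) = diff_y (diff_z p)"
  by (simp_all add: diff_x_def diff_y_def diff_z_def map_poly_map_poly o_def pderiv_map_poly
      map_poly_additive pderiv_add)

lemma poisson_bracket_jacobi:
  "poisson_bracket \<phi> (poisson_bracket \<phi> p q) r + poisson_bracket \<phi> (poisson_bracket \<phi> q r) p
     + poisson_bracket \<phi> (poisson_bracket \<phi> r p) q = 0"
  unfolding poisson_bracket_def diff_add diff_mult diff_diff diff_commute
  by (simp add: algebra_simps)

lemma poly3_generated:
  fixes S :: "'a::field_char_0 poly3 set"
  assumes "\<And>c. const3 c \<in> S" "var_x \<in> S" "var_y \<in> S" "var_z \<in> S"
    and "\<And>p q. p \<in> S \<Longrightarrow> q \<in> S \<Longrightarrow> p + q \<in> S" "\<And>p q. p \<in> S \<Longrightarrow> q \<in> S \<Longrightarrow> p * q \<in> S"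
  shows "p \<in> S"
proof -
  have 1: "[:[:a:]:] \<in> S" for a :: "'a poly"
  proof (induction a)
    case 0 then show ?case using assms(1)[of 0] by (simp add: const3_def)
  next
    case (pCons c a)
    have "[:[:pCons c a:]:] = const3 c + var_x * [:[:a:]:]"
      by (simp add: const3_def var_x_def)
    then show ?case using pCons assms by metis
  qed
  have 2: "[:b:] \<in> S" for b :: "'a poly poly"
  proof (induction b)
    case 0 then show ?case using 1[of 0] by simp
  next
    case (pCons a b)
    have "[:pCons a b:] = [:[:a:]:] + var_y * [:b:]" by (simp add: var_y_def)
    then show ?case using pCons assms 1 by metis
  qed
  show ?thesis
  proof (induction p)
    case 0 then show ?case using 2[of 0] by simp
  next
    case (pCons b p)
    have "pCons b p = [:b:] + var_z * p" by (simp add: var_z_def)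
    then show ?case using pCons assms 2 by metis
  qed
qed

lemma is_derivation_eqI:
  fixes D E :: "'a::field_char_0 poly3 \<Rightarrow> 'a poly3"
  assumes D: "is_derivation D" and E: "is_derivation E"
    and gen: "D var_x = E var_x" "D var_y = E var_y" "D var_z = E var_z"
  shows "D p = E p"
proof -
  have const: "F (const3 c) = 0" if F: "is_derivation F" for F :: "'a poly3 \<Rightarrow> 'a poly3" and c
  proof -
    have "F (1 * 1) = 1 * F 1 + 1 * F 1" using F unfolding is_derivation_def by blast
    then have "F 1 = 0" by simp
    moreover have "F (const3 c * 1) = const3 c * F 1" using F unfolding is_derivation_def by blast
    ultimately show ?thesis by simp
  qed
  have plus: "F (p + q) = F p + F q" and times: "F (p * q) = p * F q + q * F p"
    if "is_derivation F" for F :: "'a poly3 \<Rightarrow> 'a poly3" and p q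
    using that unfolding is_derivation_def by blast+
  have "p \<in> {p. D p = E p}"
    by (rule poly3_generated)
      (simp_all add: gen const[OF D] const[OF E] plus[OF D] plus[OF E] times[OF D] times[OF E])
  then show ?thesis by simp
qed

lemma poisson_bracket_unique:
  fixes P :: "'a::field_char_0 poly3 \<Rightarrow> 'a poly3 \<Rightarrow> 'a poly3"
  assumes P: "skew_biderivation P"
    and gen: "P var_x var_y = diff_z \<phi>" "P var_y var_z = diff_x \<phi>" "P var_z var_x = diff_y \<phi>"
  shows "P = poisson_bracket \<phi>"
proof -
  let ?Q = "poisson_bracket \<phi>"
  note Q = skew_biderivation_poisson_bracket[of \<phi>]
  have skew: "R p q = - R q p" if "skew_biderivation R"
    for R :: "'a poly3 \<Rightarrow> 'a poly3 \<Rightarrow> 'a poly3" and p q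
    using that unfolding skew_biderivation_def by blast
  have zero: "R p p = 0" if "skew_biderivation R"
    for R :: "'a poly3 \<Rightarrow> 'a poly3 \<Rightarrow> 'a poly3" and p
    using skew[OF that, of p p] by simp
  have der: "is_derivation (\<lambda>p. R p q)" "is_derivation (R p)"
    if "skew_biderivation R" for R :: "'a poly3 \<Rightarrow> 'a poly3 \<Rightarrow> 'a poly3" and p q
    using that unfolding skew_biderivation_def by blast+
  have gen': "P var_y var_x = - diff_z \<phi>" "P var_z var_y = - diff_x \<phi>"
      "P var_x var_z = - diff_y \<phi>"
    using gen skew[OF P] by metis+
  have genQ': "?Q var_y var_x = - diff_z \<phi>" "?Q var_z var_y = - diff_x \<phi>"
      "?Q var_x var_z = - diff_y \<phi>"
    using poisson_bracket_generators[of \<phi>] skew[OF Q] by metis+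
  have gens: "P u v = ?Q u v" if "u \<in> {var_x, var_y, var_z}" "v \<in> {var_x, var_y, var_z}" for u v
    using that
    by (elim insertE emptyE)
      (simp_all only: gen gen' genQ' poisson_bracket_generators zero[OF P] zero[OF Q])
  have left: "P u q = ?Q u q" if "u \<in> {var_x, var_y, var_z}" for u q
    by (rule is_derivation_eqI[OF der(2)[OF P] der(2)[OF Q]]) (use that gens in auto)
  have "P p q = ?Q p q" for p q
    by (rule is_derivation_eqI[OF der(1)[OF P] der(1)[OF Q]]) (use left in auto)
  then show ?thesis by blast
qed

text \<open>
  The \<open>F[[\<nu>]]\<close>-bilinear extension of \<open>\<pi>\<^sub>0 + \<pi>\<^sub>1 \<nu> + \<pi>\<^sub>2 \<nu>\<^sup>2 + \<dots>\<close> to \<open>\<A>[[\<nu>]]\<close>: the coefficient of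
  \<open>\<nu>\<^sup>n\<close> in \<open>\<pi>\<^sub>*[F, G]\<close> is the sum of all \<open>\<pi>\<^sub>i[F\<^sub>j, G\<^sub>k]\<close> with \<open>i + j + k = n\<close>.
\<close>

definition formal_bracket ::
    "(nat \<Rightarrow> 'a::field_char_0 poly3 \<Rightarrow> 'a poly3 \<Rightarrow> 'a poly3) \<Rightarrow>
       'a poly3 fps \<Rightarrow> 'a poly3 fps \<Rightarrow> 'a poly3 fps" where
  "formal_bracket \<pi> F G =
     Abs_fps (\<lambda>n. \<Sum>i\<le>n. \<Sum>j\<le>n - i. \<pi> i (fps_nth F j) (fps_nth G (n - i - j)))"

definition formal_deformation ::
    "('a::field_char_0 poly3 \<Rightarrow> 'a poly3 \<Rightarrow> 'a poly3) \<Rightarrow>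
       (nat \<Rightarrow> 'a poly3 \<Rightarrow> 'a poly3 \<Rightarrow> 'a poly3) \<Rightarrow> bool" where
  "formal_deformation P \<pi> \<longleftrightarrow>
     \<pi> 0 = P \<and> (\<forall>i. skew_biderivation (\<pi> i)) \<and>
     (\<forall>F G H. formal_bracket \<pi> (formal_bracket \<pi> F G) H
            + formal_bracket \<pi> (formal_bracket \<pi> G H) F
            + formal_bracket \<pi> (formal_bracket \<pi> H F) G = 0)"

definition formal_casimir ::
    "(nat \<Rightarrow> 'a::field_char_0 poly3 \<Rightarrow> 'a poly3 \<Rightarrow> 'a poly3) \<Rightarrow> 'a poly3 fps \<Rightarrow> bool" where
  "formal_casimir \<pi> C \<longleftrightarrow> (\<forall>F. formal_bracket \<pi> C F = 0)"

text \<open>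
  The elements of \<open>F[[\<nu>]] \<subseteq> \<A>[[\<nu>]]\<close> lie in the center of every formal deformation. The existence
  of a Casimir is therefore only a meaningful assertion outside this subring.
\<close>

definition formal_constants :: "'a::field_char_0 poly3 fps set" where
  "formal_constants = {C. \<forall>n. fps_nth C n \<in> range const3}"

end

theory Submission
  imports Defs
begin

text \<open>
  A skew-symmetric biderivation of \<open>\<A>\<close> has the form \<open>(p, q) \<mapsto> V \<cdot> (\<nabla>p \<times> \<nabla>q)\<close>, and the Jacobi
  identity for it says \<open>V \<cdot> curl V = 0\<close>. A formal deformation is thus an integrable 1-form \<open>V\<close> over
  \<open>\<A>[[\<nu>]]\<close> with \<open>V\<^sub>0 = \<nabla>\<phi>\<close>, and any \<open>C\<close> with \<open>V = g \<nabla>C\<close> is a Casimir. Such \<open>g = 1 + \<dots>\<close> and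
  \<open>C = \<phi> + \<dots>\<close> are built order by order in \<open>\<nu>\<close>: integrability makes the lowest coefficient \<open>\<omega>\<close> of
  \<open>V - g \<nabla>C\<close> satisfy \<open>\<nabla>\<phi> \<cdot> curl \<omega> = 0\<close>, and it is removed by writing \<open>\<omega> = \<nabla>c + h \<nabla>\<phi>\<close>.

  This last decomposition holds because the Koszul complex of \<open>\<nabla>\<phi>\<close> is exact: finite dimension
  of \<open>\<A>/J\<close> puts nonzero polynomials \<open>a(x)\<close>, \<open>b(y)\<close>, \<open>c(z)\<close>, which form a regular sequence, into
  \<open>J\<close>. Hence \<open>curl \<omega> = \<nabla>\<phi> \<times> b\<close> with \<open>b\<close> of smaller weight and again \<open>\<nabla>\<phi> \<cdot> curl b = 0\<close>; induction
  on the weight applies to \<open>b\<close>, and Euler's formula carries the decomposition over to \<open>\<omega>\<close>.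
\<close>

section \<open>The Jacobian ideal contains a regular sequence\<close>

text \<open>Coefficients pass through a separate map \<open>h\<close>, so that iterating the
  construction layer by layer gives substitution homomorphisms out of
  \<open>F[x][y][z]\<close>.\<close>

definition eval_hom :: "('b \<Rightarrow> 'c) \<Rightarrow> 'c \<Rightarrow> 'b::comm_ring_1 poly \<Rightarrow> 'c::comm_ring_1" where
  "eval_hom h v p = poly (map_poly h p) v"

definition hom_on_ring :: "('b::comm_ring_1 \<Rightarrow> 'c::comm_ring_1) \<Rightarrow> bool" where
  "hom_on_ring h \<longleftrightarrow> h 1 = 1 \<and> (\<forall>a b. h (a + b) = h a + h b \<and> h (a * b) = h a * h b)"

lemma hom_on_ringD:
  assumes "hom_on_ring h"
  shows "h 1 = 1" "h (a + b) = h a + h b" "h (a * b) = h a * h b" "h 0 = 0"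
proof -
  show 1: "h 1 = 1" "h (a + b) = h a + h b" "h (a * b) = h a * h b"
    using assms unfolding hom_on_ring_def by blast+
  have "h (0 + 0) = h 0 + h 0" using assms unfolding hom_on_ring_def by blast
  then show "h 0 = 0" by simp
qed

lemma eval_hom_pCons:
  assumes "h 0 = 0"
  shows "eval_hom h v 0 = 0" "eval_hom h v (pCons c p) = h c + v * eval_hom h v p"
  by (simp_all add: eval_hom_def map_poly_pCons assms)

lemma hom_on_ring_eval_hom:
  assumes "hom_on_ring h"
  shows "hom_on_ring (eval_hom h v)"
proof -
  note h = hom_on_ringD[OF assms] and e = eval_hom_pCons[of h v, OF hom_on_ringD(4)[OF assms]]
  have add: "eval_hom h v (p + q) = eval_hom h v p + eval_hom h v q" for p q
    by (simp add: eval_hom_def map_poly_additive h)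
  have smult: "eval_hom h v (smult a q) = h a * eval_hom h v q" for a q
    by (induction q) (simp_all add: e h algebra_simps)
  have "eval_hom h v (p * q) = eval_hom h v p * eval_hom h v q" for p q
    by (induction p) (simp_all add: e h add smult algebra_simps)
  moreover have "eval_hom h v 1 = 1"
    by (simp add: one_pCons e h)
  ultimately show ?thesis using add unfolding hom_on_ring_def by blast
qed

lemma eval_hom_simps:
  assumes "hom_on_ring h"
  shows "eval_hom h v 0 = 0" "eval_hom h v 1 = 1"
    "eval_hom h v (pCons c p) = h c + v * eval_hom h v p"
  using eval_hom_pCons[of h v] hom_on_ringD[OF assms] hom_on_ringD[OF hom_on_ring_eval_hom[OF assms]]
  by blast+

lemma hom_on_ring_const3: "hom_on_ring const3"
  by (simp add: hom_on_ring_def const3_def one_pCons)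

text \<open>Gaussian elimination, by induction on the set \<open>B\<close> of coordinates. Indexing
  the vectors by \<open>I\<close> lets equal vectors count separately.\<close>

lemma linear_dependence:
  fixes c :: "'i \<Rightarrow> 'b \<Rightarrow> 'a::field"
  assumes "finite B" "finite I" "card B < card I"
  shows "\<exists>l. (\<exists>i\<in>I. l i \<noteq> 0) \<and> (\<forall>b\<in>B. (\<Sum>i\<in>I. l i * c i b) = 0)"
  using assms
proof (induction B arbitrary: I c rule: finite_induct)
  case empty
  then obtain i where "i \<in> I" by fastforce
  then show ?case by (intro exI[of _ "\<lambda>_. 1"]) auto
next
  case (insert b0 B)
  show ?case
  proof (cases "\<forall>i\<in>I. c i b0 = 0")
    case True
    obtain l where "\<exists>i\<in>I. l i \<noteq> 0" "\<forall>b\<in>B. (\<Sum>i\<in>I. l i * c i b) = 0"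
      using insert.IH[of I c] insert.prems insert.hyps by auto
    with True show ?thesis by (intro exI[of _ l]) simp
  next
    case False
    then obtain k where k: "k \<in> I" "c k b0 \<noteq> 0" by blast
    define I' where "I' = I - {k}"
    have I': "finite I'" "card B < card I'" "I = insert k I'" "k \<notin> I'"
      using insert k by (auto simp: I'_def card_Diff_singleton)
    \<comment> \<open>Subtracting \<open>r i\<close> times row \<open>k\<close> clears coordinate
      \<open>b0\<close>; the multipliers are collected in the coefficient \<open>- s\<close> of row
      \<open>k\<close>.\<close>
    define r where "r i = c i b0 / c k b0" for i
    obtain l where l: "\<exists>i\<in>I'. l i \<noteq> 0" "\<And>b. b \<in> B \<Longrightarrow> (\<Sum>i\<in>I'. l i * (c i b - r i * c k b)) = 0"
      using insert.IH[of I' "\<lambda>i b. c i b - r i * c k b"] I' by auto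
    define s where "s = (\<Sum>i\<in>I'. l i * r i)"
    have S: "(\<Sum>i\<in>I. (l(k := - s)) i * c i b) = (\<Sum>i\<in>I'. l i * (c i b - r i * c k b))" for b
    proof -
      have "(\<Sum>i\<in>I. (l(k := - s)) i * c i b) = - s * c k b + (\<Sum>i\<in>I'. (l(k := - s)) i * c i b)"
        using I' by simp
      also have "(\<Sum>i\<in>I'. (l(k := - s)) i * c i b) = (\<Sum>i\<in>I'. l i * c i b)"
        by (rule sum.cong) (use I' in auto)
      finally show ?thesis
        by (simp add: s_def sum_distrib_left sum_distrib_right algebra_simps sum_subtractf)
    qed
    have "(\<Sum>i\<in>I'. l i * (c i b0 - r i * c k b0)) = 0"
      using k by (simp add: r_def)
    with l S have "\<forall>b\<in>insert b0 B. (\<Sum>i\<in>I. (l(k := - s)) i * c i b) = 0" by auto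
    moreover have "\<exists>i\<in>I. (l(k := - s)) i \<noteq> 0" using l(1) I' by auto
    ultimately show ?thesis by blast
  qed
qed

section \<open>Algebraic relations modulo the Jacobian ideal\<close>

lemma jacobian_ideal_closed:
  assumes "p \<in> jacobian_ideal \<phi>"
  shows "q \<in> jacobian_ideal \<phi> \<Longrightarrow> p + q \<in> jacobian_ideal \<phi>" "r * p \<in> jacobian_ideal \<phi>"
proof -
  obtain a b c where p: "p = a * diff_x \<phi> + b * diff_y \<phi> + c * diff_z \<phi>"
    using assms unfolding jacobian_ideal_def by blast
  show "r * p \<in> jacobian_ideal \<phi>" unfolding jacobian_ideal_def
    by (rule CollectI, rule exI[of _ "r * a"], rule exI[of _ "r * b"], rule exI[of _ "r * c"])
      (simp add: p algebra_simps)
  assume "q \<in> jacobian_ideal \<phi>"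
  then obtain a' b' c' where q: "q = a' * diff_x \<phi> + b' * diff_y \<phi> + c' * diff_z \<phi>"
    unfolding jacobian_ideal_def by blast
  show "p + q \<in> jacobian_ideal \<phi>" unfolding jacobian_ideal_def
    by (rule CollectI, rule exI[of _ "a + a'"], rule exI[of _ "b + b'"], rule exI[of _ "c + c'"])
      (simp add: p q algebra_simps)
qed

lemma const3_simps:
  "const3 (a + b) = const3 a + const3 b" "const3 (a * b) = const3 a * const3 b"
  "const3 0 = 0" "const3 1 = 1"
  using hom_on_ringD[OF hom_on_ring_const3] by blast+

lemma const3_sum: "const3 (sum g S) = (\<Sum>i\<in>S. const3 (g i))"
  by (induction S rule: infinite_finite_induct) (simp_all add: const3_simps)

text \<open>The powers of \<open>v\<close> with exponents \<open>0\<close> to \<open>card B\<close>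
  outnumber the basis of the quotient, hence are linearly dependent there.\<close>

lemma algebraic_mod_jacobian_ideal:
  assumes "isolated_singularity \<phi>"
  shows "\<exists>p. p \<noteq> 0 \<and> eval_hom const3 v p \<in> jacobian_ideal \<phi>"
proof -
  let ?J = "jacobian_ideal \<phi>"
  obtain B where B: "finite B"
    and ex: "\<And>p. \<exists>!c. (\<forall>b. b \<notin> B \<longrightarrow> c b = 0) \<and> p - (\<Sum>b\<in>B. const3 (c b) * b) \<in> ?J"
    using assms unfolding isolated_singularity_def quotient_has_dim_def quotient_basis_def by blast
  have "\<forall>n. \<exists>c. v ^ n - (\<Sum>b\<in>B. const3 (c b) * b) \<in> ?J" using ex by blast
  then obtain c where c: "\<And>n. v ^ n - (\<Sum>b\<in>B. const3 (c n b) * b) \<in> ?J" by metis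
  define I where "I = {..card B}"
  obtain l where l: "\<exists>i\<in>I. l i \<noteq> 0" "\<And>b. b \<in> B \<Longrightarrow> (\<Sum>i\<in>I. l i * c i b) = 0"
    using linear_dependence[OF B, of I c] by (auto simp: I_def)
  define p where "p = (\<Sum>i\<in>I. monom (l i) i)"
  have coeff_p: "coeff p n = (if n \<in> I then l n else 0)" for n
    unfolding p_def coeff_sum coeff_monom by (subst sum.delta) (simp_all add: I_def)
  have "p \<noteq> 0" using l(1) coeff_p by (metis coeff_0)
  note e = hom_on_ringD[OF hom_on_ring_eval_hom[OF hom_on_ring_const3]]
  have e_sum: "eval_hom const3 v (sum g S) = (\<Sum>i\<in>S. eval_hom const3 v (g i))" for g and S :: "nat set"
    by (induction S rule: infinite_finite_induct) (simp_all add: e)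
  have "eval_hom const3 v (monom a n) = const3 a * v ^ n" for a n
    by (simp add: eval_hom_def map_poly_monom const3_simps poly_monom)
  then have "eval_hom const3 v p = (\<Sum>i\<in>I. const3 (l i) * v ^ i)"
    by (simp add: p_def e_sum)
  \<comment> \<open>Each power is replaced by its difference from its representative, which lies in
    \<open>?J\<close>; the representatives cancel by the choice of \<open>l\<close>.\<close>
  also have "\<dots> = (\<Sum>i\<in>I. const3 (l i) * (v ^ i - (\<Sum>b\<in>B. const3 (c i b) * b)))"
  proof -
    have "(\<Sum>i\<in>I. const3 (l i) * (\<Sum>b\<in>B. const3 (c i b) * b))
      = (\<Sum>b\<in>B. \<Sum>i\<in>I. const3 (l i * c i b) * b)"
      unfolding sum_distrib_left by (subst sum.swap) (simp add: const3_simps mult.assoc)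
    also have "\<dots> = (\<Sum>b\<in>B. const3 (\<Sum>i\<in>I. l i * c i b) * b)"
      by (simp add: const3_sum sum_distrib_right)
    also have "\<dots> = 0" by (rule sum.neutral) (simp add: l const3_simps)
    finally show ?thesis by (simp add: right_diff_distrib sum_subtractf)
  qed
  also have "\<dots> \<in> ?J"
  proof -
    have "0 \<in> ?J" using jacobian_ideal_closed(2)[OF c[of 0], of 0] by simp
    then have "sum g S \<in> ?J" if "\<And>i. g i \<in> ?J" for g and S :: "nat set"
      by (induction S rule: infinite_finite_induct)
        (simp_all add: jacobian_ideal_closed(1) that)
    then show ?thesis using jacobian_ideal_closed(2)[OF c] by simp
  qed
  finally show ?thesis using \<open>p \<noteq> 0\<close> by blast
qed

lemma eval_hom_var:
  "eval_hom const3 var_x p = [:[:p:]:]"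
  "eval_hom const3 var_y p = [:map_poly (\<lambda>c. [:c:]) p:]"
  "eval_hom const3 var_z p = map_poly (\<lambda>c. [:[:c:]:]) p"
  by (induction p)
    (simp_all add: eval_hom_pCons const3_def var_x_def var_y_def var_z_def map_poly_pCons)

text \<open>A polynomial with unit leading coefficient is no zero divisor modulo \<open>I\<close>:
  if \<open>m\<close> is the last index with a coefficient of \<open>p\<close> outside
  \<open>I\<close>, then modulo \<open>I\<close> only the leading term of \<open>c\<close>
  contributes to coefficient \<open>degree c + m\<close> of the product.\<close>

lemma coeff_mem_ideal_cancel:
  fixes c :: "'b::comm_ring_1 poly"
  assumes zero: "0 \<in> I" and add: "\<And>a b. a \<in> I \<Longrightarrow> b \<in> I \<Longrightarrow> a + b \<in> I"
    and mult: "\<And>a b. a \<in> I \<Longrightarrow> b * a \<in> I"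
    and unit: "lead_coeff c dvd 1" and cp: "\<And>n. coeff (c * p) n \<in> I"
  shows "coeff p n \<in> I"
proof (rule ccontr)
  assume "coeff p n \<notin> I"
  define S where "S = {n. coeff p n \<notin> I}"
  have "S \<subseteq> {..degree p}" unfolding S_def using zero by (auto simp: not_less[symmetric] coeff_eq_0)
  then have fin: "finite S" by (rule finite_subset) simp
  define m where "m = Max S"
  have "S \<noteq> {}" using \<open>coeff p n \<notin> I\<close> by (auto simp: S_def)
  then have m: "m \<in> S" using fin by (simp add: m_def)
  have above: "coeff p k \<in> I" if "m < k" for k
    using Max_ge[OF fin, of k] that by (auto simp: m_def S_def)
  let ?d = "degree c"
  have sum: "sum g X \<in> I" if "\<And>i. i \<in> X \<Longrightarrow> g i \<in> I" for g and X :: "nat set"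
    using that by (induction X rule: infinite_finite_induct) (simp_all add: zero add)
  have "coeff (c * p) (?d + m) = lead_coeff c * coeff p m
      + (\<Sum>i\<in>{..?d + m} - {?d}. coeff c i * coeff p (?d + m - i))"
    unfolding coeff_mult by (subst sum.remove[of _ ?d]) simp_all
  moreover have "(\<Sum>i\<in>{..?d + m} - {?d}. coeff c i * coeff p (?d + m - i)) \<in> I" (is "?s \<in> I")
  proof (rule sum)
    fix i assume i: "i \<in> {..?d + m} - {?d}"
    show "coeff c i * coeff p (?d + m - i) \<in> I"
    proof (cases "i < ?d")
      case True then show ?thesis by (intro mult above) simp
    next
      case False then show ?thesis using i zero by (simp add: coeff_eq_0)
    qed
  qed
  then have "- 1 * ?s \<in> I" by (rule mult)
  ultimately have "lead_coeff c * coeff p m \<in> I"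
    using add[OF cp[of "?d + m"], of "- 1 * ?s"] by simp
  moreover obtain u where "1 = lead_coeff c * u" using unit by (elim dvdE)
  ultimately have "1 * coeff p m \<in> I"
    using mult[of "lead_coeff c * coeff p m" u] by (metis mult.assoc mult.commute)
  with m show False by (simp add: S_def)
qed

lemma poly_mem_ideal2:
  fixes a b :: "'b::comm_ring_1"
  shows "(\<forall>n. \<exists>u v. coeff s n = a * u + b * v) \<longleftrightarrow> (\<exists>m n. s = [:a:] * m + [:b:] * n)"
proof
  show "(\<exists>m n. s = [:a:] * m + [:b:] * n) \<Longrightarrow> \<forall>n. \<exists>u v. coeff s n = a * u + b * v" by fastforce
  show "\<forall>n. \<exists>u v. coeff s n = a * u + b * v \<Longrightarrow> \<exists>m n. s = [:a:] * m + [:b:] * n"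
  proof (induction s)
    case 0
    have "0 = [:a:] * 0 + [:b:] * 0" by simp
    then show ?case by blast
  next
    case (pCons c s)
    obtain u v where c: "c = a * u + b * v" using pCons.prems by (metis coeff_pCons_0)
    have "\<forall>n. \<exists>u v. coeff s n = a * u + b * v" using pCons.prems by (metis coeff_pCons_Suc)
    then obtain m n where "s = [:a:] * m + [:b:] * n" using pCons.IH by blast
    with c have "pCons c s = [:a:] * pCons u m + [:b:] * pCons v n" by simp
    then show ?case by blast
  qed
qed

lemma poly_dvd_iff_coeff:
  fixes a :: "'b::comm_ring_1"
  shows "[:a:] dvd s \<longleftrightarrow> (\<forall>n. a dvd coeff s n)"
  using poly_mem_ideal2[of s a 0] by (simp add: dvd_def)

lemma cancel_mod_ideal2:
  fixes c s :: "'b::comm_ring_1 poly"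
  assumes "lead_coeff c dvd 1" "c * s = [:a:] * m + [:b:] * n"
  shows "\<exists>m n. s = [:a:] * m + [:b:] * n"
proof -
  let ?I = "{a * u + b * v | u v. True}"
  have "coeff s k \<in> ?I" for k
  proof (rule coeff_mem_ideal_cancel[OF _ _ _ assms(1)])
    have "0 = a * 0 + b * 0" by simp
    then show "0 \<in> ?I" by blast
    fix x y assume "x \<in> ?I"
    then obtain u v where x: "x = a * u + b * v" by blast
    have "y * x = a * (y * u) + b * (y * v)" by (simp add: x algebra_simps)
    then show "y * x \<in> ?I" by blast
    assume "y \<in> ?I"
    then obtain u' v' where "y = a * u' + b * v'" by blast
    then have "x + y = a * (u + u') + b * (v + v')" by (simp add: x algebra_simps)
    then show "x + y \<in> ?I" by blast
  next
    fix n show "coeff (c * s) n \<in> ?I"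
      using assms(2) poly_mem_ideal2[of "c * s" a b] by blast
  qed
  then show ?thesis using poly_mem_ideal2[of s a b] by blast
qed

lemma cancel_dvd:
  fixes c s :: "'b::comm_ring_1 poly"
  assumes "lead_coeff c dvd 1" "[:a:] dvd c * s"
  shows "[:a:] dvd s"
  using cancel_mod_ideal2[OF assms(1), of s a _ 0] assms(2) by (auto simp: dvd_def)

lemma lead_coeff_map_poly_const:
  fixes p :: "'a::field poly"
  assumes "p \<noteq> 0" "\<And>c. c \<noteq> 0 \<Longrightarrow> h c \<noteq> 0 \<and> h c dvd 1" "h 0 = 0"
  shows "lead_coeff (map_poly h p) dvd (1::'b::comm_ring_1)"
proof -
  have "degree (map_poly h p) = degree p" by (rule map_poly_degree_eq) (use assms in auto)
  then show ?thesis using assms by (simp add: coeff_map_poly)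
qed

text \<open>The successive conditions of a regular sequence: \<open>a\<close> is no zero divisor,
  nor is \<open>b\<close> modulo \<open>a\<close>, nor \<open>c\<close> modulo both.\<close>

locale regular_triple =
  fixes a b c :: "'r::comm_ring_1"
  assumes a: "a * r = 0 \<Longrightarrow> r = 0"
    and b: "a dvd b * r \<Longrightarrow> a dvd r"
    and c: "c * r = a * m + b * n \<Longrightarrow> \<exists>m n. r = a * m + b * n"

text \<open>The order follows the nesting \<open>F[x][y][z]\<close>: the polynomial in
  \<open>x\<close> is constant for the outer layers, while those in \<open>y\<close> and
  \<open>z\<close> have unit leading coefficients in their own layers and so can be cancelled modulo
  the earlier ones.\<close>

lemma isolated_singularity_regular_triple:
  assumes "isolated_singularity \<phi>"
  shows "\<exists>a b c. regular_triple a b c \<and> {a, b, c} \<subseteq> jacobian_ideal \<phi>"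
proof -
  obtain p q r where nz: "p \<noteq> 0" "q \<noteq> 0" "r \<noteq> 0"
    and J: "[:[:p:]:] \<in> jacobian_ideal \<phi>" "[:map_poly (\<lambda>c. [:c:]) q:] \<in> jacobian_ideal \<phi>"
      "map_poly (\<lambda>c. [:[:c:]:]) r \<in> jacobian_ideal \<phi>"
    using algebraic_mod_jacobian_ideal[OF assms] by (metis eval_hom_var)
  let ?q = "map_poly (\<lambda>c. [:c:]) q" and ?r = "map_poly (\<lambda>c. [:[:c:]:]) r"
  have q: "lead_coeff ?q dvd 1" 
    by (rule lead_coeff_map_poly_const) (auto simp: nz is_unit_const_poly_iff dvd_field_iff)
  have r: "lead_coeff ?r dvd 1"
    by (rule lead_coeff_map_poly_const) (auto simp: nz is_unit_const_poly_iff dvd_field_iff)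
  have "regular_triple [:[:p:]:] [:?q:] ?r"
  proof
    fix s :: "'a poly3" assume "[:[:p:]:] * s = 0"
    moreover have "[:[:p:]:] \<noteq> 0" using nz by simp
    ultimately show "s = 0" by (metis mult_eq_0_iff)
  next
    fix s :: "'a poly3" assume "[:[:p:]:] dvd [:?q:] * s"
    then have "[:p:] dvd ?q * coeff s n" for n
      by (simp add: poly_dvd_iff_coeff[of "[:p:]"])
    then have "[:p:] dvd coeff s n" for n using cancel_dvd[OF q] by blast
    then show "[:[:p:]:] dvd s" by (simp add: poly_dvd_iff_coeff[of "[:p:]"])
  qed (rule cancel_mod_ideal2[OF r])
  with J show ?thesis by blast
qed

text \<open>A zero gradient gives a zero ideal, but a regular triple cannot start with 0 in a
  nonzero ring. This excludes constant \<open>\<phi>\<close>.\<close>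

lemma isolated_singularity_gradient:
  assumes "isolated_singularity \<phi>"
  shows "\<not> (diff_x \<phi> = 0 \<and> diff_y \<phi> = 0 \<and> diff_z \<phi> = 0)"
proof
  assume "diff_x \<phi> = 0 \<and> diff_y \<phi> = 0 \<and> diff_z \<phi> = 0"
  then have "jacobian_ideal \<phi> = {0}" by (simp add: jacobian_ideal_def)
  then obtain b c where "regular_triple 0 b (c :: 'a poly3)"
    using isolated_singularity_regular_triple[OF assms] by auto
  then show False using regular_triple.a[of 0 b c 1] by simp
qed

section \<open>Exactness of the Koszul complex\<close>

text \<open>
  Depth sensitivity of the Koszul complex, made explicit. With \<open>a = p \<cdot> f\<close> and \<open>u = w \<times> p\<close>,
  \<open>f \<cdot> w = 0\<close> gives \<open>a w = f \<times> u\<close>; using \<open>b\<close> and \<open>c\<close>, the vector \<open>u\<close> is a multiple of \<open>f\<close>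
  modulo \<open>a\<close>, and then \<open>a\<close> can be cancelled.
\<close>

lemma regular_triple_koszul_exact:
  fixes a b c :: "'r::idom"
  assumes reg: "regular_triple a b c"
    and a: "a = p1 * f1 + p2 * f2 + p3 * f3" and b: "b = q1 * f1 + q2 * f2 + q3 * f3"
    and c: "c = r1 * f1 + r2 * f2 + r3 * f3"
    and w: "f1 * w1 + f2 * w2 + f3 * w3 = 0"
  shows "\<exists>v1 v2 v3. w1 = f2 * v3 - f3 * v2 \<and> w2 = f3 * v1 - f1 * v3 \<and> w3 = f1 * v2 - f2 * v1"
proof -
  define u1 u2 u3 where u: "u1 = w2 * p3 - w3 * p2" "u2 = w3 * p1 - w1 * p3" "u3 = w1 * p2 - w2 * p1"
  define s where "s = q1 * u1 + q2 * u2 + q3 * u3"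
  have aw: "a * w1 = f2 * u3 - f3 * u2" "a * w2 = f3 * u1 - f1 * u3" "a * w3 = f1 * u2 - f2 * u1"
    unfolding a u using w by algebra+
  \<comment> \<open>The triple product rule \<open>q \<times> (f \<times> u) = (q \<cdot> u) f - (q
    \<cdot> f) u\<close>, with \<open>f \<times> u = a w\<close>. Pairing the result with
    \<open>r\<close> then puts \<open>c * s\<close> into the ideal of \<open>a\<close> and
    \<open>b\<close>.\<close>
  have bu: "b * u1 = f1 * s - a * (q2 * w3 - q3 * w2)" "b * u2 = f2 * s - a * (q3 * w1 - q1 * w3)"
      "b * u3 = f3 * s - a * (q1 * w2 - q2 * w1)"
    unfolding b s_def using aw by algebra+
  have "c * s = a * (r1 * (q2 * w3 - q3 * w2) + r2 * (q3 * w1 - q1 * w3) + r3 * (q1 * w2 - q2 * w1))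
      + b * (r1 * u1 + r2 * u2 + r3 * u3)"
    unfolding c using bu by algebra
  then obtain k h where s: "s = a * k + b * h" using regular_triple.c[OF reg] by blast
  have "b * (u1 - h * f1) = a * (k * f1 - (q2 * w3 - q3 * w2))"
    "b * (u2 - h * f2) = a * (k * f2 - (q3 * w1 - q1 * w3))"
    "b * (u3 - h * f3) = a * (k * f3 - (q1 * w2 - q2 * w1))"
    using bu s by algebra+
  then have "a dvd u1 - h * f1" "a dvd u2 - h * f2" "a dvd u3 - h * f3"
    by (metis dvd_triv_left regular_triple.b[OF reg])+
  then obtain v1 v2 v3 where v: "u1 - h * f1 = a * v1" "u2 - h * f2 = a * v2" "u3 - h * f3 = a * v3"
    unfolding dvd_def by blast
  have "a * (w1 - (f2 * v3 - f3 * v2)) = 0" "a * (w2 - (f3 * v1 - f1 * v3)) = 0"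
      "a * (w3 - (f1 * v2 - f2 * v1)) = 0"
    using aw v by algebra+
  then have "w1 - (f2 * v3 - f3 * v2) = 0" "w2 - (f3 * v1 - f1 * v3) = 0"
      "w3 - (f1 * v2 - f2 * v1) = 0"
    using regular_triple.a[OF reg] by blast+
  then show ?thesis by (intro exI[of _ v1] exI[of _ v2] exI[of _ v3]) simp
qed

lemma jacobian_koszul_exact:
  assumes "isolated_singularity \<phi>"
    and "diff_x \<phi> * w1 + diff_y \<phi> * w2 + diff_z \<phi> * w3 = 0"
  shows "\<exists>v1 v2 v3. w1 = diff_y \<phi> * v3 - diff_z \<phi> * v2 \<and> w2 = diff_z \<phi> * v1 - diff_x \<phi> * v3
    \<and> w3 = diff_x \<phi> * v2 - diff_y \<phi> * v1"
proof -
  obtain a b c where reg: "regular_triple a b c" and "a \<in> jacobian_ideal \<phi>" "b \<in> jacobian_ideal \<phi>"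
    "c \<in> jacobian_ideal \<phi>"
    using isolated_singularity_regular_triple[OF assms(1)] by blast
  then show ?thesis unfolding jacobian_ideal_def
    using regular_triple_koszul_exact[OF reg _ _ _ assms(2)] by blast
qed

section \<open>Calculus rules for the partial derivatives, also coefficientwise\<close>

lemma diff_zero [simp]: "diff_x 0 = 0" "diff_y 0 = 0" "diff_z 0 = 0"
  by (simp_all add: diff_x_def diff_y_def diff_z_def)

lemma diff_1: "diff_x 1 = 0" "diff_y 1 = 0" "diff_z 1 = 0"
  by (simp_all flip: const3_simps(4))

lemma diff_const_mult:
  "diff_x (const3 k * p) = const3 k * diff_x p"
  "diff_y (const3 k * p) = const3 k * diff_y p"
  "diff_z (const3 k * p) = const3 k * diff_z p"
  by (simp_all add: diff_mult)

lemma const3_of_nat: "const3 (of_nat n) = of_nat n"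
  by (induction n) (simp_all add: const3_simps)

lemma diff_of_nat [simp]: "diff_x (of_nat n) = 0" "diff_y (of_nat n) = 0" "diff_z (of_nat n) = 0"
  by (simp_all flip: const3_of_nat)

lemma diff_sum:
  "diff_x (sum g S) = (\<Sum>i\<in>S. diff_x (g i))"
  "diff_y (sum g S) = (\<Sum>i\<in>S. diff_y (g i))"
  "diff_z (sum g S) = (\<Sum>i\<in>S. diff_z (g i))"
  by (induction S rule: infinite_finite_induct) (simp_all add: diff_add)

lemma map_poly_monom_mult:
  fixes f :: "'b::comm_ring_1 \<Rightarrow> 'b"
  assumes "f 0 = 0"
  shows "map_poly f (monom 1 n * p) = monom 1 n * map_poly f p"
  by (rule poly_eqI) (simp add: coeff_map_poly coeff_monom_mult assms)

lemma map_poly_diff_mult: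
  "map_poly diff_x (P * Q) = P * map_poly diff_x Q + Q * map_poly diff_x P"
  "map_poly diff_y (P * Q) = P * map_poly diff_y Q + Q * map_poly diff_y P"
  "map_poly diff_z (P * Q) = P * map_poly diff_z Q + Q * map_poly diff_z P"
  by (rule map_poly_leibniz; simp add: diff_add diff_mult)+

lemma map_poly_diff_add:
  "map_poly diff_x (P + Q) = map_poly diff_x P + map_poly diff_x Q"
  "map_poly diff_y (P + Q) = map_poly diff_y P + map_poly diff_y Q"
  "map_poly diff_z (P + Q) = map_poly diff_z P + map_poly diff_z Q"
  by (rule map_poly_additive; simp add: diff_add)+

lemma coeff_monom_mult_pderiv:
  "coeff (monom 1 (Suc 0) * pderiv Q) n = of_nat n * coeff Q n"
  by (cases n) (simp_all add: coeff_monom_mult coeff_pderiv)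

text \<open>In characteristic zero, the eigenvectors of \<open>t d/dt\<close> with eigenvalue
  \<open>m\<close> are the multiples of \<open>t^m\<close>.\<close>

lemma monom_mult_pderiv_eqD:
  assumes "monom 1 (Suc 0) * pderiv Q = of_nat m * (Q :: 'a::field_char_0 poly3 poly)"
  shows "Q = monom (coeff Q m) m"
proof (rule poly_eqI)
  fix n
  have "coeff (of_nat m * Q) n = of_nat m * coeff Q n"
    by (simp add: of_nat_poly)
  then have "of_nat n * coeff Q n = of_nat m * coeff Q n"
    by (metis assms coeff_monom_mult_pderiv)
  then show "coeff Q n = coeff (monom (coeff Q m) m) n" by (cases "m = n") auto
qed

section \<open>Weights and relatively closed forms\<close>

locale weights =
  fixes w1 w2 w3 :: nat
  assumes pos: "w1 > 0" "w2 > 0" "w3 > 0"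
begin

definition euler :: "'a::field_char_0 poly3 \<Rightarrow> 'a poly3" where
  "euler p = of_nat w1 * var_x * diff_x p + of_nat w2 * var_y * diff_y p
    + of_nat w3 * var_z * diff_z p"

text \<open>
  The weight grading is encoded in the ring homomorphism \<open>\<A> \<rightarrow> \<A>[t]\<close> with
  \<open>x \<mapsto> x t\<^bsup>w1\<^esup>\<close>, \<open>y \<mapsto> y t\<^bsup>w2\<^esup>\<close>, \<open>z \<mapsto> z t\<^bsup>w3\<^esup>\<close>:
  the coefficient of \<open>t\<^sup>n\<close> in the image of \<open>p\<close> is the part of \<open>p\<close> of weight \<open>n\<close>.
\<close>

definition weight_hom :: "'a::field_char_0 poly3 \<Rightarrow> 'a poly3 poly" where
  "weight_hom = eval_hom (eval_hom (eval_hom (\<lambda>c. [:const3 c:]) (monom var_x w1)) (monom var_y w2))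
    (monom var_z w3)"

lemma hom_on_ring_weight_hom: "hom_on_ring weight_hom"
proof -
  have "hom_on_ring (\<lambda>c. [:const3 c:])"
    by (simp add: hom_on_ring_def const3_simps one_pCons)
  then show ?thesis unfolding weight_hom_def by (intro hom_on_ring_eval_hom)
qed

lemmas weight_hom_simps = hom_on_ringD[OF hom_on_ring_weight_hom]

lemma weight_hom_generators:
  fixes c :: "'a::field_char_0"
  shows "weight_hom (const3 c) = [:const3 c:]" "weight_hom var_x = monom (var_x :: 'a poly3) w1"
    "weight_hom var_y = monom (var_y :: 'a poly3) w2" "weight_hom var_z = monom (var_z :: 'a poly3) w3"
proof -
  define h where "h = (\<lambda>c::'a. [:const3 c:])"
  have 1: "hom_on_ring h"
    by (simp add: h_def hom_on_ring_def const3_simps one_pCons)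
  note 2 = hom_on_ring_eval_hom[OF 1]
  note 3 = hom_on_ring_eval_hom[OF 2]
  note [simp] = eval_hom_simps[OF 1] eval_hom_simps[OF 2] eval_hom_simps[OF 3] hom_on_ringD[OF 1]
  show "weight_hom (const3 c) = [:const3 c:]" "weight_hom var_x = monom (var_x :: 'a poly3) w1"
    "weight_hom var_y = monom (var_y :: 'a poly3) w2" "weight_hom var_z = monom (var_z :: 'a poly3) w3"
    unfolding weight_hom_def h_def[symmetric]
    by (simp_all add: const3_def[of c] var_x_def var_y_def var_z_def) (simp add: h_def const3_def)
qed

lemma weight_hom_of_nat: "weight_hom (of_nat n) = of_nat n"
  by (induction n) (simp_all add: weight_hom_simps)

lemma weight_hom_diff: "weight_hom (p - q) = weight_hom p - weight_hom q"
  using weight_hom_simps(2)[of "p - q" q] by (simp add: algebra_simps)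

text \<open>Setting \<open>t = 1\<close> adds up the parts of all weights. This carries identities
  in \<open>\<A>[t]\<close> back to \<open>\<A>\<close>.\<close>

lemma poly_weight_hom_1: "poly (weight_hom p) 1 = p"
proof -
  have "p \<in> {p. poly (weight_hom p) 1 = p}"
    by (rule poly3_generated) (simp_all add: weight_hom_simps weight_hom_generators poly_monom)
  then show ?thesis by simp
qed

lemma euler_simps:
  "euler (p + q) = euler p + euler q" "euler (p * q) = p * euler q + q * euler p"
  "euler 0 = 0" "euler (const3 c) = 0" "euler var_x = of_nat w1 * var_x"
  "euler var_y = of_nat w2 * var_y" "euler var_z = of_nat w3 * var_z"
  by (simp_all add: euler_def diff_add diff_mult algebra_simps)

lemma of_nat_mult_monom: "of_nat k * monom v w = monom (of_nat k * v) w"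
  "monom v w * of_nat k = monom (v * of_nat k) w"
  by (induction k) (simp_all add: algebra_simps flip: add_monom)

lemma monom_pderiv_monom:
  assumes "w > 0"
  shows "monom 1 (Suc 0) * pderiv (monom v w) = of_nat w * (monom v w :: 'a::field_char_0 poly3 poly)"
  using assms by (simp add: pderiv_monom mult_monom of_nat_poly smult_monom)

text \<open>Both the Euler field and \<open>t d/dt\<close> multiply the part of weight
  \<open>n\<close> by \<open>n\<close>. By the product rule it is enough to compare them on
  generators.\<close>

lemma weight_hom_euler: "weight_hom (euler p) = monom 1 (Suc 0) * pderiv (weight_hom p)"
proof -
  have "p \<in> {p. weight_hom (euler p) = monom 1 (Suc 0) * pderiv (weight_hom p)}"
    by (rule poly3_generated)
      (simp_all add: weight_hom_simps weight_hom_generators weight_hom_of_nat euler_simps pos monom_pderiv_monom pderiv_pCons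
        pderiv_add pderiv_mult algebra_simps)
  then show ?thesis by simp
qed

text \<open>With the Euler field acting on coefficients instead, each coefficient of
  \<open>t^n\<close> is seen to be an eigenvector with eigenvalue \<open>n\<close>.\<close>

lemma map_poly_euler_weight_hom: "map_poly euler (weight_hom p) = monom 1 (Suc 0) * pderiv (weight_hom p)"
proof -
  have m: "map_poly euler (P * Q) = P * map_poly euler Q + Q * map_poly euler P"
    "map_poly euler (P + Q) = map_poly euler P + map_poly euler Q" for P Q
    by (rule map_poly_leibniz map_poly_additive; simp add: euler_simps)+
  have "p \<in> {p. map_poly euler (weight_hom p) = monom 1 (Suc 0) * pderiv (weight_hom p)}"
    by (rule poly3_generated)
      (simp_all add: weight_hom_simps weight_hom_generators m euler_simps pos monom_pderiv_monom pderiv_pCons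
        map_poly_pCons map_poly_monom pderiv_add pderiv_mult algebra_simps flip: of_nat_mult_monom)
  then show ?thesis by simp
qed

text \<open>A partial derivative lowers the weight by that of its variable; the monomial factor
  restores it and avoids negative exponents.\<close>

lemma map_poly_diff_weight_hom:
  "map_poly diff_x (weight_hom p) = monom 1 w1 * weight_hom (diff_x p)"
  "map_poly diff_y (weight_hom p) = monom 1 w2 * weight_hom (diff_y p)"
  "map_poly diff_z (weight_hom p) = monom 1 w3 * weight_hom (diff_z p)"
proof -
  have "p \<in> {p. map_poly diff_x (weight_hom p) = monom 1 w1 * weight_hom (diff_x p)}"
    "p \<in> {p. map_poly diff_y (weight_hom p) = monom 1 w2 * weight_hom (diff_y p)}"
    "p \<in> {p. map_poly diff_z (weight_hom p) = monom 1 w3 * weight_hom (diff_z p)}"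
    by (rule poly3_generated;
        simp add: weight_hom_simps weight_hom_generators map_poly_diff_mult map_poly_diff_add diff_add diff_mult
        map_poly_pCons map_poly_monom algebra_simps)+
  then show "map_poly diff_x (weight_hom p) = monom 1 w1 * weight_hom (diff_x p)"
    "map_poly diff_y (weight_hom p) = monom 1 w2 * weight_hom (diff_y p)"
    "map_poly diff_z (weight_hom p) = monom 1 w3 * weight_hom (diff_z p)" by simp_all
qed

text \<open>
  Here \<open>w\<close> is a weight offset: for \<open>w = w1\<close> the predicate says that the form \<open>p dx\<close> has weight \<open>m\<close>.
\<close>

definition homog :: "nat \<Rightarrow> nat \<Rightarrow> 'a::field_char_0 poly3 \<Rightarrow> bool" where
  "homog w m p \<longleftrightarrow> monom 1 w * weight_hom p = monom p m"

lemma monom_pderiv_weight_hom: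
  "monom 1 (Suc 0) * pderiv (monom 1 w * weight_hom p) = of_nat w * (monom 1 w * weight_hom p) + monom 1 w * weight_hom (euler p)"
proof (cases "w = 0")
  case False
  have "monom 1 (Suc 0) * pderiv (monom 1 w * weight_hom p)
    = monom 1 w * (monom 1 (Suc 0) * pderiv (weight_hom p)) + weight_hom p * (monom 1 (Suc 0) * pderiv (monom 1 w))"
    by (simp only: pderiv_mult) (simp add: algebra_simps)
  also have "\<dots> = monom 1 w * weight_hom (euler p) + weight_hom p * (of_nat w * monom 1 w)"
    using False by (simp only: weight_hom_euler monom_pderiv_monom)
  finally show ?thesis by (simp add: algebra_simps)
qed (simp add: weight_hom_euler flip: one_poly_eq_simps(1))

text \<open>Apply \<open>t d/dt\<close> and set \<open>t = 1\<close>; conversely, an eigenvector of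
  \<open>t d/dt\<close> is a single monomial, whose coefficient is read off at
  \<open>t = 1\<close>.\<close>

lemma homog_iff_euler: "homog w m p \<longleftrightarrow> of_nat w * p + euler p = of_nat m * p"
proof
  assume "homog w m p"
  then have eq: "monom 1 w * weight_hom p = monom p m" by (simp add: homog_def)
  have "monom 1 (Suc 0) * pderiv (monom p m) = of_nat m * monom p m"
    by (cases "m = 0") (simp add: pderiv_monom, simp only: monom_pderiv_monom neq0_conv)
  then have "monom 1 w * weight_hom (of_nat m * p) = monom 1 w * weight_hom (of_nat w * p + euler p)"
    using monom_pderiv_weight_hom[of w p] eq by (simp add: weight_hom_simps weight_hom_of_nat algebra_simps)
  then have "poly (weight_hom (of_nat m * p)) 1 = poly (weight_hom (of_nat w * p + euler p)) 1" by simp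
  then show "of_nat w * p + euler p = of_nat m * p" by (simp only: poly_weight_hom_1)
next
  assume e: "of_nat w * p + euler p = of_nat m * p"
  let ?Q = "monom 1 w * weight_hom p"
  have "monom 1 (Suc 0) * pderiv ?Q = monom 1 w * weight_hom (of_nat w * p + euler p)"
    by (simp add: monom_pderiv_weight_hom weight_hom_simps weight_hom_of_nat algebra_simps)
  also have "\<dots> = of_nat m * ?Q" unfolding e by (simp add: weight_hom_simps weight_hom_of_nat algebra_simps)
  finally have Q: "?Q = monom (coeff ?Q m) m" by (rule monom_mult_pderiv_eqD)
  then have "poly ?Q 1 = coeff ?Q m" by (metis poly_monom mult.right_neutral power_one)
  then have "coeff ?Q m = p" by (simp add: poly_weight_hom_1 poly_monom)
  with Q show "homog w m p" by (simp add: homog_def)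
qed

lemma homog_part: "homog w m (coeff (monom 1 w * weight_hom p) m)"
proof -
  let ?Q = "monom 1 w * weight_hom p"
  have "monom 1 (Suc 0) * pderiv ?Q = of_nat w * ?Q + map_poly euler ?Q"
    by (simp add: monom_pderiv_weight_hom map_poly_monom_mult map_poly_euler_weight_hom weight_hom_euler euler_simps)
  then have "coeff (monom 1 (Suc 0) * pderiv ?Q) m = of_nat w * coeff ?Q m + euler (coeff ?Q m)"
    by (simp add: of_nat_poly coeff_map_poly euler_simps)
  moreover have "coeff (monom 1 (Suc 0) * pderiv ?Q) m = of_nat m * coeff ?Q m"
    by (rule coeff_monom_mult_pderiv)
  ultimately show ?thesis by (simp add: homog_iff_euler)
qed

text \<open>Any degree bound \<open>N\<close> is allowed, so that the three components of a form can
  be summed over a common range.\<close>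

lemma sum_parts:
  assumes "degree (monom 1 w * weight_hom p) \<le> N"
  shows "p = (\<Sum>m\<le>N. coeff (monom 1 w * weight_hom p) m)"
proof -
  have "p = poly (monom 1 w * weight_hom p) 1" by (simp add: poly_weight_hom_1 poly_monom)
  also have "\<dots> = (\<Sum>m\<le>N. coeff (monom 1 w * weight_hom p) m)"
    unfolding poly_altdef using assms
    by (simp add: sum.mono_neutral_left coeff_eq_0)
  finally show ?thesis .
qed

section \<open>Decomposing relatively closed forms, weight by weight\<close>

lemma homog_diff:
  assumes "homog 0 d \<phi>"
  shows "monom 1 w1 * weight_hom (diff_x \<phi>) = monom (diff_x \<phi>) d"
    "monom 1 w2 * weight_hom (diff_y \<phi>) = monom (diff_y \<phi>) d"
    "monom 1 w3 * weight_hom (diff_z \<phi>) = monom (diff_z \<phi>) d"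
proof -
  have "weight_hom \<phi> = monom \<phi> d" using assms by (simp add: homog_def flip: one_poly_eq_simps(1))
  then show "monom 1 w1 * weight_hom (diff_x \<phi>) = monom (diff_x \<phi>) d"
    "monom 1 w2 * weight_hom (diff_y \<phi>) = monom (diff_y \<phi>) d"
    "monom 1 w3 * weight_hom (diff_z \<phi>) = monom (diff_z \<phi>) d"
    by (simp_all add: map_poly_monom flip: map_poly_diff_weight_hom)
qed

lemma homog_0D:
  assumes "homog w 0 p" "w > 0"
  shows "p = 0"
proof -
  have "coeff (monom 1 w * weight_hom p) 0 = 0" using assms(2) by (simp add: coeff_monom_mult)
  then show ?thesis using assms(1) by (simp add: homog_def)
qed

text \<open>Strong induction on \<open>m\<close>: the Koszul hypothesis gives
  \<open>curl \<omega> = \<nabla>\<phi> \<times> u\<close>, the part \<open>b\<close> of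
  \<open>u\<close> of weight \<open>m - d\<close> is again relatively closed, and
  \<open>d > 0\<close> makes the weight drop.\<close>

lemma relative_closed_homog:
  fixes \<phi> :: "'a::field_char_0 poly3"
  assumes \<phi>: "homog 0 d \<phi>" "d > 0"
    and koszul: "\<And>v1 v2 v3. diff_x \<phi> * v1 + diff_y \<phi> * v2 + diff_z \<phi> * v3 = 0 \<Longrightarrow>
      \<exists>u1 u2 u3. v1 = diff_y \<phi> * u3 - diff_z \<phi> * u2 \<and> v2 = diff_z \<phi> * u1 - diff_x \<phi> * u3
        \<and> v3 = diff_x \<phi> * u2 - diff_y \<phi> * u1"
    and "homog w1 m o1" "homog w2 m o2" "homog w3 m o3"
    and "diff_x \<phi> * (diff_y o3 - diff_z o2) + diff_y \<phi> * (diff_z o1 - diff_x o3)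
      + diff_z \<phi> * (diff_x o2 - diff_y o1) = 0"
  shows "\<exists>c h. o1 = diff_x c + h * diff_x \<phi> \<and> o2 = diff_y c + h * diff_y \<phi>
    \<and> o3 = diff_z c + h * diff_z \<phi>"
  using assms(4-)
proof (induction m arbitrary: o1 o2 o3 rule: less_induct)
  case (less m)
  let ?f1 = "diff_x \<phi>" and ?f2 = "diff_y \<phi>" and ?f3 = "diff_z \<phi>"
  define v1 v2 v3 where v: "v1 = diff_y o3 - diff_z o2" "v2 = diff_z o1 - diff_x o3"
    "v3 = diff_x o2 - diff_y o1"
  obtain u1 u2 u3 where u: "v1 = ?f2 * u3 - ?f3 * u2" "v2 = ?f3 * u1 - ?f1 * u3"
    "v3 = ?f1 * u2 - ?f2 * u1"
    using koszul[of v1 v2 v3] less.prems(4) v by metis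
  let ?B = "\<lambda>w u. monom 1 w * weight_hom u"
  \<comment> \<open>For \<open>d > m\<close> the value is 0, where truncated subtraction would pick
    the part of weight 0.\<close>
  define b where "b w u = (if d \<le> m then coeff (?B w u) (m - d) else 0)" for w and u :: "'a poly3"
  note o = less.prems(1-3)[unfolded homog_def]
  note f = homog_diff[OF \<phi>(1)]
  have mono_diff: "monom 1 w * map_poly diff_x (weight_hom p) = map_poly diff_x (monom 1 w * weight_hom p)"
    "monom 1 w * map_poly diff_y (weight_hom p) = map_poly diff_y (monom 1 w * weight_hom p)"
    "monom 1 w * map_poly diff_z (weight_hom p) = map_poly diff_z (monom 1 w * weight_hom p)"
    for w and p :: "'a poly3"
    by (simp_all add: map_poly_monom_mult)
  \<comment> \<open>Each component of the curl, as a 2-form, is offset by the weights of two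
    variables; in this sense \<open>curl \<omega>\<close> again has weight \<open>m\<close>.\<close>
  have curl: "monom 1 w2 * (monom 1 w3 * weight_hom v1) = monom v1 m"
    "monom 1 w3 * (monom 1 w1 * weight_hom v2) = monom v2 m"
    "monom 1 w1 * (monom 1 w2 * weight_hom v3) = monom v3 m"
  proof -
    have "monom 1 w2 * (monom 1 w3 * weight_hom v1)
      = monom 1 w3 * (monom 1 w2 * weight_hom (diff_y o3)) - monom 1 w2 * (monom 1 w3 * weight_hom (diff_z o2))"
      unfolding v weight_hom_diff by (simp add: algebra_simps)
    then show "monom 1 w2 * (monom 1 w3 * weight_hom v1) = monom v1 m"
      unfolding map_poly_diff_weight_hom[symmetric] mono_diff o by (simp add: map_poly_monom v diff_monom)
    have "monom 1 w3 * (monom 1 w1 * weight_hom v2)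
      = monom 1 w1 * (monom 1 w3 * weight_hom (diff_z o1)) - monom 1 w3 * (monom 1 w1 * weight_hom (diff_x o3))"
      unfolding v weight_hom_diff by (simp add: algebra_simps)
    then show "monom 1 w3 * (monom 1 w1 * weight_hom v2) = monom v2 m"
      unfolding map_poly_diff_weight_hom[symmetric] mono_diff o by (simp add: map_poly_monom v diff_monom)
    have "monom 1 w1 * (monom 1 w2 * weight_hom v3)
      = monom 1 w2 * (monom 1 w1 * weight_hom (diff_x o2)) - monom 1 w1 * (monom 1 w2 * weight_hom (diff_y o1))"
      unfolding v weight_hom_diff by (simp add: algebra_simps)
    then show "monom 1 w1 * (monom 1 w2 * weight_hom v3) = monom v3 m"
      unfolding map_poly_diff_weight_hom[symmetric] mono_diff o by (simp add: map_poly_monom v diff_monom)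
  qed
  have coeff_b: "coeff (monom p d * ?B w u) m = p * b w u" for p w u
    by (simp add: b_def coeff_monom_mult not_le)
  \<comment> \<open>As \<open>\<nabla>\<phi>\<close> has weight \<open>d\<close>, only the part of
    \<open>u\<close> of weight \<open>m - d\<close> contributes to the coefficient of
    \<open>t^m\<close> in \<open>\<nabla>\<phi> \<times> u\<close>.\<close>
  have vb: "v1 = ?f2 * b w3 u3 - ?f3 * b w2 u2" "v2 = ?f3 * b w1 u1 - ?f1 * b w3 u3"
      "v3 = ?f1 * b w2 u2 - ?f2 * b w1 u1"
  proof -
    have "monom v1 m = (monom 1 w2 * weight_hom ?f2) * ?B w3 u3 - (monom 1 w3 * weight_hom ?f3) * ?B w2 u2"
      unfolding curl(1)[symmetric] unfolding u weight_hom_diff weight_hom_simps by (simp add: algebra_simps)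
    then have "coeff (monom v1 m) m = coeff (monom ?f2 d * ?B w3 u3 - monom ?f3 d * ?B w2 u2) m"
      by (simp only: f)
    then show "v1 = ?f2 * b w3 u3 - ?f3 * b w2 u2" by (simp only: coeff_diff coeff_b coeff_monom) simp
    have "monom v2 m = (monom 1 w3 * weight_hom ?f3) * ?B w1 u1 - (monom 1 w1 * weight_hom ?f1) * ?B w3 u3"
      unfolding curl(2)[symmetric] unfolding u weight_hom_diff weight_hom_simps by (simp add: algebra_simps)
    then have "coeff (monom v2 m) m = coeff (monom ?f3 d * ?B w1 u1 - monom ?f1 d * ?B w3 u3) m"
      by (simp only: f)
    then show "v2 = ?f3 * b w1 u1 - ?f1 * b w3 u3" by (simp only: coeff_diff coeff_b coeff_monom) simp
    have "monom v3 m = (monom 1 w1 * weight_hom ?f1) * ?B w2 u2 - (monom 1 w2 * weight_hom ?f2) * ?B w1 u1"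
      unfolding curl(3)[symmetric] unfolding u weight_hom_diff weight_hom_simps by (simp add: algebra_simps)
    then have "coeff (monom v3 m) m = coeff (monom ?f1 d * ?B w2 u2 - monom ?f2 d * ?B w1 u1) m"
      by (simp only: f)
    then show "v3 = ?f1 * b w2 u2 - ?f2 * b w1 u1" by (simp only: coeff_diff coeff_b coeff_monom) simp
  qed
  define b1 b2 b3 where b123: "b1 = b w1 u1" "b2 = b w2 u2" "b3 = b w3 u3"
  note vb = vb[folded b123]
  have "\<exists>c h. b1 = diff_x c + h * ?f1 \<and> b2 = diff_y c + h * ?f2 \<and> b3 = diff_z c + h * ?f3"
  proof (cases "d \<le> m")
    case False
    then show ?thesis by (intro exI[of _ 0]) (simp add: b123 b_def)
  next
    case True
    show ?thesis
    proof (rule less.IH)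
      show "m - d < m" using True \<phi>(2) by simp
      show "homog w1 (m - d) b1" "homog w2 (m - d) b2" "homog w3 (m - d) b3"
        using True by (simp_all add: b123 b_def homog_part)
      \<comment> \<open>The divergence of a curl vanishes, and that of
        \<open>\<nabla>\<phi> \<times> b\<close> is
        \<open>- \<nabla>\<phi> \<cdot> curl b\<close>.\<close>
      have "diff_x v1 + diff_y v2 + diff_z v3 = 0"
        by (simp add: v diff_diff diff_commute)
      then show "?f1 * (diff_y b3 - diff_z b2) + ?f2 * (diff_z b1 - diff_x b3)
        + ?f3 * (diff_x b2 - diff_y b1) = 0"
        unfolding vb diff_diff diff_mult diff_commute by (simp add: algebra_simps)
    qed
  qed
  then obtain c h where b: "b1 = diff_x c + h * ?f1" "b2 = diff_y c + h * ?f2"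
    "b3 = diff_z c + h * ?f3" by blast
  show ?case
  proof (cases "m = 0")
    \<comment> \<open>Division by \<open>m\<close> is impossible here, but positive offsets leave
      only the zero form in weight 0.\<close>
    case True
    then have "o1 = 0" "o2 = 0" "o3 = 0" using less.prems(1-3) pos homog_0D by blast+
    then show ?thesis by (intro exI[of _ 0]) simp
  next
    case False
    define e1 e2 e3 where e: "e1 = of_nat w1 * (var_x :: 'a poly3)"
      "e2 = of_nat w2 * (var_y :: 'a poly3)" "e3 = of_nat w3 * (var_z :: 'a poly3)"
    have de: "diff_x e1 = of_nat w1" "diff_x e2 = 0" "diff_x e3 = 0"
      "diff_y e1 = 0" "diff_y e2 = of_nat w2" "diff_y e3 = 0"
      "diff_z e1 = 0" "diff_z e2 = 0" "diff_z e3 = of_nat w3"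
      by (simp_all add: e diff_mult)
    have eu: "euler p = e1 * diff_x p + e2 * diff_y p + e3 * diff_z p" for p
      by (simp add: euler_def e)
    define d' :: "'a poly3" where "d' = of_nat d"
    define m' :: "'a poly3" where "m' = of_nat m"
    have dd: "diff_x d' = 0" "diff_y d' = 0" "diff_z d' = 0" by (simp_all add: d'_def)
    have ephi: "e1 * ?f1 + e2 * ?f2 + e3 * ?f3 = d' * \<phi>"
      using \<phi>(1) by (simp add: homog_iff_euler eu d'_def)
    note eo = less.prems(1-3)[unfolded homog_iff_euler eu, folded m'_def]
    have curl_b: "diff_y o3 - diff_z o2 = ?f2 * b3 - ?f3 * b2" 
      "diff_z o1 - diff_x o3 = ?f3 * b1 - ?f1 * b3" "diff_x o2 - diff_y o1 = ?f1 * b2 - ?f2 * b1"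
      using vb v by simp_all
    \<comment> \<open>Cartan's formula \<open>m \<omega> = \<nabla>(E \<cdot> \<omega>) - E \<times> curl \<omega>\<close> for the Euler field \<open>E\<close>, where
      \<open>curl \<omega> = \<nabla>\<phi> \<times> b\<close> and \<open>E \<cdot> \<nabla>\<phi> = d \<phi>\<close>.\<close>
    define c' where "c' = e1 * o1 + e2 * o2 + e3 * o3 + d' * \<phi> * c"
    \<comment> \<open>The term \<open>d \<phi> b\<close> with
      \<open>b = \<nabla>c + h \<nabla>\<phi>\<close> equals
      \<open>\<nabla>(d \<phi> c) + d (\<phi> h - c) \<nabla>\<phi>\<close> by the product
      rule.\<close>
    define h' where "h' = d' * (\<phi> * h - c) - (e1 * b1 + e2 * b2 + e3 * b3)"
    define eb where "eb = e1 * b1 + e2 * b2 + e3 * b3"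
    have "diff_x c' + h' * ?f1
      = of_nat w1 * o1 + (e1 * diff_x o1 + e2 * diff_y o1 + e3 * diff_z o1)
        + (e2 * (diff_x o2 - diff_y o1) - e3 * (diff_z o1 - diff_x o3))
        + d' * \<phi> * (diff_x c + h * ?f1) - eb * ?f1"
      unfolding c'_def h'_def eb_def[symmetric] diff_add diff_mult de dd by (simp add: algebra_simps)
    also have "\<dots> = m' * o1
        + (e2 * (?f1 * b2 - ?f2 * b1) - e3 * (?f3 * b1 - ?f1 * b3))
        + (e1 * ?f1 + e2 * ?f2 + e3 * ?f3) * b1 - eb * ?f1"
      by (simp only: eo curl_b ephi b[symmetric])
    also have "\<dots> = m' * o1" by (simp add: eb_def algebra_simps)
    finally have mo1: "m' * o1 = diff_x c' + h' * ?f1" by simp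
    have "diff_y c' + h' * ?f2
      = of_nat w2 * o2 + (e1 * diff_x o2 + e2 * diff_y o2 + e3 * diff_z o2)
        + (e3 * (diff_y o3 - diff_z o2) - e1 * (diff_x o2 - diff_y o1))
        + d' * \<phi> * (diff_y c + h * ?f2) - eb * ?f2"
      unfolding c'_def h'_def eb_def[symmetric] diff_add diff_mult de dd by (simp add: algebra_simps)
    also have "\<dots> = m' * o2
        + (e3 * (?f2 * b3 - ?f3 * b2) - e1 * (?f1 * b2 - ?f2 * b1))
        + (e1 * ?f1 + e2 * ?f2 + e3 * ?f3) * b2 - eb * ?f2"
      by (simp only: eo curl_b ephi b[symmetric])
    also have "\<dots> = m' * o2" by (simp add: eb_def algebra_simps)
    finally have mo2: "m' * o2 = diff_y c' + h' * ?f2" by simp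
    have "diff_z c' + h' * ?f3
      = of_nat w3 * o3 + (e1 * diff_x o3 + e2 * diff_y o3 + e3 * diff_z o3)
        + (e1 * (diff_z o1 - diff_x o3) - e2 * (diff_y o3 - diff_z o2))
        + d' * \<phi> * (diff_z c + h * ?f3) - eb * ?f3"
      unfolding c'_def h'_def eb_def[symmetric] diff_add diff_mult de dd by (simp add: algebra_simps)
    also have "\<dots> = m' * o3
        + (e1 * (?f3 * b1 - ?f1 * b3) - e2 * (?f2 * b3 - ?f3 * b2))
        + (e1 * ?f1 + e2 * ?f2 + e3 * ?f3) * b3 - eb * ?f3"
      by (simp only: eo curl_b ephi b[symmetric])
    also have "\<dots> = m' * o3" by (simp add: eb_def algebra_simps)
    finally have mo3: "m' * o3 = diff_z c' + h' * ?f3" by simp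
    note mo = mo1 mo2 mo3
    let ?k = "const3 (1 / of_nat m)"
    have "?k * m' = 1" using False
      by (simp add: m'_def const3_simps flip: const3_of_nat) (simp flip: const3_simps)
    then have k: "p = ?k * (m' * p)" for p by (simp flip: mult.assoc)
    show ?thesis
    proof (intro exI conjI)
      show "o1 = diff_x (?k * c') + (?k * h') * ?f1"
        by (subst k[of o1], subst mo(1)) (simp only: diff_const_mult distrib_left mult.assoc)
      show "o2 = diff_y (?k * c') + (?k * h') * ?f2"
        by (subst k[of o2], subst mo(2)) (simp only: diff_const_mult distrib_left mult.assoc)
      show "o3 = diff_z (?k * c') + (?k * h') * ?f3"
        by (subst k[of o3], subst mo(3)) (simp only: diff_const_mult distrib_left mult.assoc)
    qed
  qed
qed

text \<open>Since \<open>\<nabla>\<phi>\<close> is homogeneous, the closedness condition splits by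
  weight; the homogeneous solutions are summed.\<close>

lemma relative_closed:
  fixes \<phi> :: "'a::field_char_0 poly3"
  assumes \<phi>: "homog 0 d \<phi>" "d > 0"
    and koszul: "\<And>v1 v2 v3. diff_x \<phi> * v1 + diff_y \<phi> * v2 + diff_z \<phi> * v3 = 0 \<Longrightarrow>
      \<exists>u1 u2 u3. v1 = diff_y \<phi> * u3 - diff_z \<phi> * u2 \<and> v2 = diff_z \<phi> * u1 - diff_x \<phi> * u3
        \<and> v3 = diff_x \<phi> * u2 - diff_y \<phi> * u1"
    and closed: "diff_x \<phi> * (diff_y o3 - diff_z o2) + diff_y \<phi> * (diff_z o1 - diff_x o3)
      + diff_z \<phi> * (diff_x o2 - diff_y o1) = 0"
  shows "\<exists>c h. o1 = diff_x c + h * diff_x \<phi> \<and> o2 = diff_y c + h * diff_y \<phi>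
    \<and> o3 = diff_z c + h * diff_z \<phi>"
proof -
  define O1 O2 O3 where O: "O1 = monom 1 w1 * weight_hom o1" "O2 = monom 1 w2 * weight_hom o2" "O3 = monom 1 w3 * weight_hom o3"
  have "\<exists>c h. coeff O1 m = diff_x c + h * diff_x \<phi> \<and> coeff O2 m = diff_y c + h * diff_y \<phi>
    \<and> coeff O3 m = diff_z c + h * diff_z \<phi>" for m
  proof (rule relative_closed_homog[OF \<phi> koszul])
    show "homog w1 m (coeff O1 m)" "homog w2 m (coeff O2 m)" "homog w3 m (coeff O3 m)"
      unfolding O by (rule homog_part)+
    have dO: "map_poly diff_y O3 = monom 1 w3 * (monom 1 w2 * weight_hom (diff_y o3))"
      "map_poly diff_z O2 = monom 1 w2 * (monom 1 w3 * weight_hom (diff_z o2))"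
      "map_poly diff_z O1 = monom 1 w1 * (monom 1 w3 * weight_hom (diff_z o1))"
      "map_poly diff_x O3 = monom 1 w3 * (monom 1 w1 * weight_hom (diff_x o3))"
      "map_poly diff_x O2 = monom 1 w2 * (monom 1 w1 * weight_hom (diff_x o2))"
      "map_poly diff_y O1 = monom 1 w1 * (monom 1 w2 * weight_hom (diff_y o1))"
      by (simp_all only: O map_poly_monom_mult diff_zero map_poly_diff_weight_hom)
    \<comment> \<open>The coefficient of \<open>t^m\<close> in \<open>Z\<close> is the condition on
      the parts of weight \<open>m\<close>. Up to a power of \<open>t\<close> on each side,
      \<open>Z\<close> is the image of the given condition under \<open>weight_hom\<close>, hence
      0.\<close>
    define Z where "Z = [:diff_x \<phi>:] * (map_poly diff_y O3 - map_poly diff_z O2)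
      + [:diff_y \<phi>:] * (map_poly diff_z O1 - map_poly diff_x O3)
      + [:diff_z \<phi>:] * (map_poly diff_x O2 - map_poly diff_y O1)"
    have f: "monom 1 d * [:diff_x \<phi>:] = monom 1 w1 * weight_hom (diff_x \<phi>)"
      "monom 1 d * [:diff_y \<phi>:] = monom 1 w2 * weight_hom (diff_y \<phi>)"
      "monom 1 d * [:diff_z \<phi>:] = monom 1 w3 * weight_hom (diff_z \<phi>)"
      using homog_diff[OF \<phi>(1)] by (simp_all add: smult_monom)
    have "monom 1 d * Z = monom 1 d * [:diff_x \<phi>:] * (map_poly diff_y O3 - map_poly diff_z O2)
      + monom 1 d * [:diff_y \<phi>:] * (map_poly diff_z O1 - map_poly diff_x O3)
      + monom 1 d * [:diff_z \<phi>:] * (map_poly diff_x O2 - map_poly diff_y O1)"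
      unfolding Z_def by (simp only: distrib_left mult.assoc)
    also have "\<dots> = monom 1 w1 * (monom 1 w2 * (monom 1 w3 *
      weight_hom (diff_x \<phi> * (diff_y o3 - diff_z o2) + diff_y \<phi> * (diff_z o1 - diff_x o3)
      + diff_z \<phi> * (diff_x o2 - diff_y o1))))"
      unfolding f dO weight_hom_simps weight_hom_diff by (simp only: algebra_simps)
    also have "\<dots> = 0" by (simp add: closed weight_hom_simps)
    finally have "Z = 0" by simp
    then have "coeff Z m = 0" by simp
    then show "diff_x \<phi> * (diff_y (coeff O3 m) - diff_z (coeff O2 m))
      + diff_y \<phi> * (diff_z (coeff O1 m) - diff_x (coeff O3 m))
      + diff_z \<phi> * (diff_x (coeff O2 m) - diff_y (coeff O1 m)) = 0"
      by (simp add: Z_def coeff_map_poly)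
  qed
  then obtain c h where ch: "\<And>m. coeff O1 m = diff_x (c m) + h m * diff_x \<phi>"
    "\<And>m. coeff O2 m = diff_y (c m) + h m * diff_y \<phi>"
    "\<And>m. coeff O3 m = diff_z (c m) + h m * diff_z \<phi>" by metis
  define N where "N = max (degree O1) (max (degree O2) (degree O3))"
  have "o1 = (\<Sum>m\<le>N. coeff O1 m)" "o2 = (\<Sum>m\<le>N. coeff O2 m)" "o3 = (\<Sum>m\<le>N. coeff O3 m)"
    unfolding O by (rule sum_parts; simp add: N_def O)+
  then have "o1 = diff_x (\<Sum>m\<le>N. c m) + (\<Sum>m\<le>N. h m) * diff_x \<phi>"
    "o2 = diff_y (\<Sum>m\<le>N. c m) + (\<Sum>m\<le>N. h m) * diff_y \<phi>"
    "o3 = diff_z (\<Sum>m\<le>N. c m) + (\<Sum>m\<le>N. h m) * diff_z \<phi>"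
    by (simp_all add: ch sum.distrib diff_sum sum_distrib_right)
  then show ?thesis by blast
qed

end

lemma relative_closed_exact:
  fixes \<phi> :: "'a::field_char_0 poly3"
  assumes "weight_homogeneous \<phi>" and sing: "isolated_singularity \<phi>"
    and closed: "diff_x \<phi> * (diff_y o3 - diff_z o2) + diff_y \<phi> * (diff_z o1 - diff_x o3)
      + diff_z \<phi> * (diff_x o2 - diff_y o1) = 0"
  shows "\<exists>c h. o1 = diff_x c + h * diff_x \<phi> \<and> o2 = diff_y c + h * diff_y \<phi>
    \<and> o3 = diff_z c + h * diff_z \<phi>"
proof -
  obtain w1 w2 w3 d :: nat where w: "w1 > 0" "w2 > 0" "w3 > 0"
    and e: "of_nat w1 * var_x * diff_x \<phi> + of_nat w2 * var_y * diff_y \<phi>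
          + of_nat w3 * var_z * diff_z \<phi> = of_nat d * \<phi>"
    using assms(1) unfolding weight_homogeneous_def by blast
  interpret weights w1 w2 w3 by unfold_locales (use w in auto)
  have homog: "homog 0 d \<phi>" using e by (simp add: homog_iff_euler euler_def)
  show ?thesis
  proof (cases "d = 0")
    \<comment> \<open>All components of the gradient would have weight 0 with positive offset, hence
      vanish.\<close>
    case True
    then have "diff_x \<phi> = 0" "diff_y \<phi> = 0" "diff_z \<phi> = 0"
      using homog_diff[OF homog] w homog_0D unfolding homog_def by blast+
    with isolated_singularity_gradient[OF sing] show ?thesis by blast
  next
    case False
    then show ?thesis
      using relative_closed[OF homog _ jacobian_koszul_exact[OF sing] closed] by blast
  qed
qed

section \<open>Formal integration\<close>

definition fps_map :: "('b \<Rightarrow> 'c) \<Rightarrow> 'b fps \<Rightarrow> 'c fps" where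
  "fps_map D F = Abs_fps (\<lambda>n. D (fps_nth F n))"

lemma fps_map_nth [simp]: "fps_nth (fps_map D F) n = D (fps_nth F n)"
  by (simp add: fps_map_def)

lemma fps_map_diff_add:
  "fps_map diff_x (F + G) = fps_map diff_x F + fps_map diff_x G"
  "fps_map diff_y (F + G) = fps_map diff_y F + fps_map diff_y G"
  "fps_map diff_z (F + G) = fps_map diff_z F + fps_map diff_z G"
  by (simp_all add: fps_eq_iff diff_add)

lemma fps_map_diff_mult:
  "fps_map diff_x (F * G) = F * fps_map diff_x G + fps_map diff_x F * G"
  "fps_map diff_y (F * G) = F * fps_map diff_y G + fps_map diff_y F * G"
  "fps_map diff_z (F * G) = F * fps_map diff_z G + fps_map diff_z F * G"
  by (simp_all add: fps_eq_iff fps_mult_nth diff_sum diff_mult sum.distrib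
      mult.commute[of "diff_x _"] mult.commute[of "diff_y _"] mult.commute[of "diff_z _"])

lemma fps_map_diff_commute:
  "fps_map diff_y (fps_map diff_x F) = fps_map diff_x (fps_map diff_y F)"
  "fps_map diff_z (fps_map diff_x F) = fps_map diff_x (fps_map diff_z F)"
  "fps_map diff_z (fps_map diff_y F) = fps_map diff_y (fps_map diff_z F)"
  by (simp_all add: fps_eq_iff diff_commute)

lemma fps_map_diff_const:
  "fps_map diff_x (fps_const c) = fps_const (diff_x c)"
  "fps_map diff_y (fps_const c) = fps_const (diff_y c)"
  "fps_map diff_z (fps_const c) = fps_const (diff_z c)"
  by (simp_all add: fps_eq_iff)

lemma fps_map_diff_X_power_mult:
  "fps_map diff_x (fps_X ^ n * F) = fps_X ^ n * fps_map diff_x F"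
  "fps_map diff_y (fps_X ^ n * F) = fps_X ^ n * fps_map diff_y F"
  "fps_map diff_z (fps_X ^ n * F) = fps_X ^ n * fps_map diff_z F"
  by (simp_all add: fps_eq_iff fps_X_power_mult_nth)

lemma fps_mult_nth_vanishing:
  fixes F R :: "'b::comm_ring_1 fps"
  assumes "\<And>k. k < n \<Longrightarrow> fps_nth R k = 0"
  shows "fps_nth (F * R) n = fps_nth F 0 * fps_nth R n"
proof -
  have "fps_nth (F * R) n = (\<Sum>i\<in>{0..n}. if i = 0 then fps_nth F 0 * fps_nth R n else 0)"
    unfolding fps_mult_nth by (rule sum.cong) (use assms in auto)
  then show ?thesis by simp
qed

section \<open>Biderivations in coordinates\<close>

lemma derivation_expansion:
  fixes D :: "'a::field_char_0 poly3 \<Rightarrow> 'a poly3"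
  assumes "is_derivation D"
  shows "D p = D var_x * diff_x p + D var_y * diff_y p + D var_z * diff_z p"
  by (rule is_derivation_eqI[OF assms])
    (simp_all add: is_derivation_def diff_add diff_mult algebra_simps)

text \<open>Expanding both arguments by the chain rule leaves nine terms; skew symmetry kills the
  diagonal ones and pairs the others.\<close>

lemma skew_biderivation_expansion:
  fixes P :: "'a::field_char_0 poly3 \<Rightarrow> 'a poly3 \<Rightarrow> 'a poly3"
  assumes P: "skew_biderivation P"
  shows "P p q = P var_y var_z * (diff_y p * diff_z q - diff_z p * diff_y q)
    + P var_z var_x * (diff_z p * diff_x q - diff_x p * diff_z q)
    + P var_x var_y * (diff_x p * diff_y q - diff_y p * diff_x q)"
proof -
  have skew: "P p q = - P q p" for p q using P unfolding skew_biderivation_def by blast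
  have zero: "P p p = 0" for p using skew[of p p] by simp
  have der: "is_derivation (\<lambda>p. P p q)" "is_derivation (P q)" for q
    using P unfolding skew_biderivation_def by blast+
  have l: "P p q = P var_x q * diff_x p + P var_y q * diff_y p + P var_z q * diff_z p"
    using derivation_expansion[OF der(1)] .
  have r: "P u q = P u var_x * diff_x q + P u var_y * diff_y q + P u var_z * diff_z q" for u
    using derivation_expansion[OF der(2)] .
  show ?thesis unfolding l r[of var_x] r[of var_y] r[of var_z] zero
      skew[of var_y var_x] skew[of var_z var_y] skew[of var_x var_z]
    by (simp add: algebra_simps)
qed

lemma formal_bracket_expansion:
  fixes \<pi> :: "nat \<Rightarrow> 'a::field_char_0 poly3 \<Rightarrow> 'a poly3 \<Rightarrow> 'a poly3"
  assumes "\<And>i. skew_biderivation (\<pi> i)"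
  shows "formal_bracket \<pi> F G =
      Abs_fps (\<lambda>i. \<pi> i var_y var_z)
        * (fps_map diff_y F * fps_map diff_z G - fps_map diff_z F * fps_map diff_y G)
    + Abs_fps (\<lambda>i. \<pi> i var_z var_x)
        * (fps_map diff_z F * fps_map diff_x G - fps_map diff_x F * fps_map diff_z G)
    + Abs_fps (\<lambda>i. \<pi> i var_x var_y)
        * (fps_map diff_x F * fps_map diff_y G - fps_map diff_y F * fps_map diff_x G)"
proof -
  define V1 V2 V3 where V: "V1 = Abs_fps (\<lambda>i. \<pi> i var_y var_z)"
    "V2 = Abs_fps (\<lambda>i. \<pi> i var_z var_x)" "V3 = Abs_fps (\<lambda>i. \<pi> i var_x var_y)"
  have "\<pi> i p q = fps_nth V1 i * (diff_y p * diff_z q - diff_z p * diff_y q)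
    + fps_nth V2 i * (diff_z p * diff_x q - diff_x p * diff_z q)
    + fps_nth V3 i * (diff_x p * diff_y q - diff_y p * diff_x q)" for i p q
    unfolding V fps_nth_Abs_fps by (rule skew_biderivation_expansion[OF assms])
  then show ?thesis
    unfolding V[symmetric] formal_bracket_def
    by (simp add: fps_eq_iff fps_mult_nth atLeast0AtMost sum_distrib_left sum.distrib sum_subtractf
        right_diff_distrib)
qed

text \<open>The remainder \<open>R = V - g \<nabla>C\<close> starts at order \<open>n\<close>.
  Integrability makes its leading coefficient relatively closed, so it is
  \<open>\<nabla>c + h \<nabla>\<phi>\<close>; adding \<open>h\<close> to \<open>g\<close> and
  \<open>c\<close> to \<open>C\<close> at order \<open>n\<close> removes it.\<close>

lemma formal_frobenius_step:
  fixes \<phi> :: "'a::field_char_0 poly3" and V1 V2 V3 g C :: "'a poly3 fps"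
  assumes integrable: "V1 * (fps_map diff_y V3 - fps_map diff_z V2)
      + V2 * (fps_map diff_z V1 - fps_map diff_x V3)
      + V3 * (fps_map diff_x V2 - fps_map diff_y V1) = 0"
    and exact: "\<And>o1 o2 o3. diff_x \<phi> * (diff_y o3 - diff_z o2) + diff_y \<phi> * (diff_z o1 - diff_x o3)
      + diff_z \<phi> * (diff_x o2 - diff_y o1) = 0 \<Longrightarrow>
      \<exists>c h. o1 = diff_x c + h * diff_x \<phi> \<and> o2 = diff_y c + h * diff_y \<phi>
        \<and> o3 = diff_z c + h * diff_z \<phi>"
    and g: "fps_nth g 0 = 1" and C: "fps_nth C 0 = \<phi>" and "n > 0"
    and low: "\<And>k. k < n \<Longrightarrow> fps_nth V1 k = fps_nth (g * fps_map diff_x C) k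
        \<and> fps_nth V2 k = fps_nth (g * fps_map diff_y C) k
        \<and> fps_nth V3 k = fps_nth (g * fps_map diff_z C) k"
  shows "\<exists>g' C'. (\<forall>k<n. fps_nth g' k = fps_nth g k \<and> fps_nth C' k = fps_nth C k)
    \<and> (\<forall>k\<le>n. fps_nth V1 k = fps_nth (g' * fps_map diff_x C') k
        \<and> fps_nth V2 k = fps_nth (g' * fps_map diff_y C') k
        \<and> fps_nth V3 k = fps_nth (g' * fps_map diff_z C') k)"
proof -
  let ?X = "fps_map diff_x" and ?Y = "fps_map diff_y" and ?Z = "fps_map diff_z"
  define R1 R2 R3 where R: "R1 = V1 - g * ?X C" "R2 = V2 - g * ?Y C" "R3 = V3 - g * ?Z C"
  have R0: "fps_nth R1 k = 0" "fps_nth R2 k = 0" "fps_nth R3 k = 0" if "k < n" for k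
    using low[OF that] by (simp_all add: R)
  have V: "V1 = g * ?X C + R1" "V2 = g * ?Y C + R2" "V3 = g * ?Z C + R3" by (simp_all add: R)
  \<comment> \<open>With \<open>curl V = \<nabla>g \<times> \<nabla>C + curl R\<close>, the product
    \<open>V \<cdot> curl V\<close> splits into \<open>P = g \<nabla>C \<cdot> curl R\<close>,
    \<open>Q = (\<nabla>g \<times> \<nabla>C) \<cdot> R\<close> and
    \<open>S = curl R \<cdot> R\<close>; the remaining term is a vanishing triple product.\<close>
  define P where "P = g * ?X C * (?Y R3 - ?Z R2) + g * ?Y C * (?Z R1 - ?X R3)
      + g * ?Z C * (?X R2 - ?Y R1)"
  define Q where "Q = (?Y g * ?Z C - ?Z g * ?Y C) * R1 + (?Z g * ?X C - ?X g * ?Z C) * R2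
      + (?X g * ?Y C - ?Y g * ?X C) * R3"
  define S where "S = (?Y R3 - ?Z R2) * R1 + (?Z R1 - ?X R3) * R2 + (?X R2 - ?Y R1) * R3"
  have "P + Q + S = 0"
    using integrable unfolding V P_def Q_def S_def fps_map_diff_add fps_map_diff_mult
      fps_map_diff_commute by (simp add: algebra_simps)
  then have "fps_nth P n + fps_nth Q n + fps_nth S n = 0" by (metis fps_add_nth fps_zero_nth)
  \<comment> \<open>\<open>R\<close> has order at least \<open>n\<close>, and its cofactors have no
    constant term: \<open>\<nabla>g\<close> because \<open>g\<close> starts with 1,
    \<open>curl R\<close> because \<open>n > 0\<close>.\<close>
  moreover have "fps_nth Q n = 0" "fps_nth S n = 0"
    unfolding Q_def S_def fps_add_nth using \<open>n > 0\<close>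
    by (simp_all add: fps_mult_nth_vanishing R0 g diff_1)
  moreover have "fps_nth P n = diff_x \<phi> * (diff_y (fps_nth R3 n) - diff_z (fps_nth R2 n))
    + diff_y \<phi> * (diff_z (fps_nth R1 n) - diff_x (fps_nth R3 n))
      + diff_z \<phi> * (diff_x (fps_nth R2 n) - diff_y (fps_nth R1 n))"
    unfolding P_def fps_add_nth
    by (subst (1 2 3) fps_mult_nth_vanishing) (simp_all add: R0 g C)
  ultimately obtain c h where ch: "fps_nth R1 n = diff_x c + h * diff_x \<phi>"
    "fps_nth R2 n = diff_y c + h * diff_y \<phi>" "fps_nth R3 n = diff_z c + h * diff_z \<phi>"
    using exact[of "fps_nth R3 n" "fps_nth R2 n" "fps_nth R1 n"] by auto
  define g' where "g' = g + fps_X ^ n * fps_const h"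
  define C' where "C' = C + fps_X ^ n * fps_const c"
  \<comment> \<open>The corrections enter linearly up to order \<open>n\<close>, since their product
    has order \<open>2 n > n\<close>.\<close>
  have X: "fps_nth (g' * (D + fps_X ^ n * fps_const u)) k
    = fps_nth (g * D) k + (if k = n then u + h * fps_nth D 0 else 0)" if "k \<le> n" for D u k
  proof -
    have "g' * (D + fps_X ^ n * fps_const u) = g * D
      + fps_X ^ n * (g * fps_const u + fps_const h * D + fps_X ^ n * fps_const (h * u))"
      by (simp add: g'_def algebra_simps)
    then show ?thesis using that \<open>n > 0\<close> by (simp add: fps_X_power_mult_nth g)
  qed
  have dC': "?X C' = ?X C + fps_X ^ n * fps_const (diff_x c)"
    "?Y C' = ?Y C + fps_X ^ n * fps_const (diff_y c)"
    "?Z C' = ?Z C + fps_X ^ n * fps_const (diff_z c)"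
    by (simp_all only: C'_def fps_map_diff_add fps_map_diff_X_power_mult fps_map_diff_const)
  have Vn: "fps_nth V1 n = fps_nth (g * ?X C) n + (diff_x c + h * diff_x \<phi>)"
    "fps_nth V2 n = fps_nth (g * ?Y C) n + (diff_y c + h * diff_y \<phi>)"
    "fps_nth V3 n = fps_nth (g * ?Z C) n + (diff_z c + h * diff_z \<phi>)"
    by (simp_all only: V fps_add_nth ch)
  show ?thesis
  proof (rule exI[of _ g'], rule exI[of _ C'], intro conjI allI impI)
    fix k assume "k < n"
    then show "fps_nth g' k = fps_nth g k" "fps_nth C' k = fps_nth C k"
      by (simp_all add: g'_def C'_def fps_X_power_mult_nth)
  next
    fix k assume k: "k \<le> n"
    show "fps_nth V1 k = fps_nth (g' * ?X C') k" "fps_nth V2 k = fps_nth (g' * ?Y C') k"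
      "fps_nth V3 k = fps_nth (g' * ?Z C') k"
      unfolding dC' X[OF k] using low[of k] k Vn by (auto simp: C le_less)
  qed
qed

text \<open>Dependent choice gives approximate solutions that agree to increasing order; their
  diagonal is an exact solution.\<close>

lemma formal_frobenius:
  fixes \<phi> :: "'a::field_char_0 poly3" and V1 V2 V3 :: "'a poly3 fps"
  assumes integrable: "V1 * (fps_map diff_y V3 - fps_map diff_z V2)
      + V2 * (fps_map diff_z V1 - fps_map diff_x V3)
      + V3 * (fps_map diff_x V2 - fps_map diff_y V1) = 0"
    and exact: "\<And>o1 o2 o3. diff_x \<phi> * (diff_y o3 - diff_z o2) + diff_y \<phi> * (diff_z o1 - diff_x o3)
      + diff_z \<phi> * (diff_x o2 - diff_y o1) = 0 \<Longrightarrow>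
      \<exists>c h. o1 = diff_x c + h * diff_x \<phi> \<and> o2 = diff_y c + h * diff_y \<phi>
        \<and> o3 = diff_z c + h * diff_z \<phi>"
    and V0: "fps_nth V1 0 = diff_x \<phi>" "fps_nth V2 0 = diff_y \<phi>" "fps_nth V3 0 = diff_z \<phi>"
  shows "\<exists>g C. fps_nth C 0 = \<phi> \<and> V1 = g * fps_map diff_x C \<and> V2 = g * fps_map diff_y C
    \<and> V3 = g * fps_map diff_z C"
proof -
  define solves where "solves g C k \<longleftrightarrow> fps_nth V1 k = fps_nth (g * fps_map diff_x C) k
        \<and> fps_nth V2 k = fps_nth (g * fps_map diff_y C) k
        \<and> fps_nth V3 k = fps_nth (g * fps_map diff_z C) k" for g C k
  define inv where "inv n s \<longleftrightarrow> fps_nth (fst s) 0 = 1 \<and> fps_nth (snd s) 0 = \<phi>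
    \<and> (\<forall>k\<le>n. solves (fst s) (snd s) k)" for n :: nat and s
  define agree where "agree n s t \<longleftrightarrow> (\<forall>k\<le>n. fps_nth (fst t) k = fps_nth (fst s) k
    \<and> fps_nth (snd t) k = fps_nth (snd s) k)"
    for n :: nat and s t :: "'a poly3 fps \<times> 'a poly3 fps"
  have "\<exists>s. \<forall>n. inv n (s n) \<and> agree n (s n) (s (Suc n))"
  proof (rule dependent_nat_choice)
    show "\<exists>s. inv 0 s"
      by (rule exI[of _ "(1, fps_const \<phi>)"]) (simp add: inv_def solves_def V0)
  next
    fix s n assume s: "inv n s"
    then obtain g' C' where *: "\<forall>k<Suc n. fps_nth g' k = fps_nth (fst s) k
        \<and> fps_nth C' k = fps_nth (snd s) k" "\<forall>k\<le>Suc n. solves g' C' k"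
      using formal_frobenius_step[OF integrable exact, of "fst s" "snd s" "Suc n"]
      unfolding inv_def solves_def by (auto simp: less_Suc_eq_le)
    then have "inv (Suc n) (g', C')" "agree n s (g', C')"
      using s by (simp_all add: inv_def agree_def less_Suc_eq_le)
    then show "\<exists>t. inv (Suc n) t \<and> agree n s t" by blast
  qed
  then obtain s where s: "\<And>n. inv n (s n)" "\<And>n. agree n (s n) (s (Suc n))" by blast
  \<comment> \<open>Coefficient \<open>k\<close> is final from stage \<open>k\<close> on, which
    justifies the diagonal definitions of \<open>g\<close> and \<open>C\<close>.\<close>
  have stable: "fps_nth (fst (s (k + j))) k = fps_nth (fst (s k)) k
    \<and> fps_nth (snd (s (k + j))) k = fps_nth (snd (s k)) k" for k j
  proof (induction j)
    case (Suc j)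
    with s(2)[of "k + j"] show ?case by (simp add: agree_def)
  qed simp
  define g where "g = Abs_fps (\<lambda>n. fps_nth (fst (s n)) n)"
  define C where "C = Abs_fps (\<lambda>n. fps_nth (snd (s n)) n)"
  have gC: "fps_nth g k = fps_nth (fst (s n)) k" "fps_nth C k = fps_nth (snd (s n)) k"
    if "k \<le> n" for k n
    using stable[of k "n - k"] that by (simp_all add: g_def C_def)
  have "fps_nth (g * fps_map D C) n = fps_nth (fst (s n) * fps_map D (snd (s n))) n"
    for D :: "'a poly3 \<Rightarrow> 'a poly3" and n
    by (simp add: fps_mult_nth gC[of _ n])
  moreover have "solves (fst (s n)) (snd (s n)) n" for n
    using s(1)[of n] by (simp add: inv_def)
  ultimately have "V1 = g * fps_map diff_x C" "V2 = g * fps_map diff_y C" "V3 = g * fps_map diff_z C"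
    by (simp_all add: fps_eq_iff solves_def)
  moreover have "fps_nth C 0 = \<phi>" using s(1)[of 0] by (simp add: C_def inv_def)
  ultimately show ?thesis by blast
qed

section \<open>The Casimir of a formal deformation\<close>

theorem corollary3p8:
  fixes \<phi> :: "'a::field_char_0 poly3"
    and \<pi> :: "nat \<Rightarrow> 'a poly3 \<Rightarrow> 'a poly3 \<Rightarrow> 'a poly3"
  assumes "weight_homogeneous \<phi>"
    and "isolated_singularity \<phi>"
    and "formal_deformation (poisson_bracket \<phi>) \<pi>"
  shows "\<exists>C. formal_casimir \<pi> C \<and> C \<notin> formal_constants"
proof -
  have \<pi>0: "\<pi> 0 = poisson_bracket \<phi>" and bider: "\<And>i. skew_biderivation (\<pi> i)"
    and jacobi: "\<And>F G H. formal_bracket \<pi> (formal_bracket \<pi> F G) H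
      + formal_bracket \<pi> (formal_bracket \<pi> G H) F + formal_bracket \<pi> (formal_bracket \<pi> H F) G = 0"
    using assms(3) unfolding formal_deformation_def by blast+
  define V1 V2 V3 where V: "V1 = Abs_fps (\<lambda>i. \<pi> i var_y var_z)"
    "V2 = Abs_fps (\<lambda>i. \<pi> i var_z var_x)" "V3 = Abs_fps (\<lambda>i. \<pi> i var_x var_y)"
  note bracket = formal_bracket_expansion[OF bider]
  \<comment> \<open>The Jacobi identity for the three coordinates is exactly
    \<open>V \<cdot> curl V = 0\<close>.\<close>
  have "V1 * (fps_map diff_y V3 - fps_map diff_z V2) + V2 * (fps_map diff_z V1 - fps_map diff_x V3)
      + V3 * (fps_map diff_x V2 - fps_map diff_y V1) = 0"
    using jacobi[of "fps_const var_x" "fps_const var_y" "fps_const var_z"]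
    by (simp add: V bracket fps_map_diff_const algebra_simps)
  moreover have "fps_nth V1 0 = diff_x \<phi>" "fps_nth V2 0 = diff_y \<phi>" "fps_nth V3 0 = diff_z \<phi>"
    by (simp_all add: V \<pi>0 poisson_bracket_generators)
  ultimately obtain g C where C: "fps_nth C 0 = \<phi>" "V1 = g * fps_map diff_x C"
    "V2 = g * fps_map diff_y C" "V3 = g * fps_map diff_z C"
    using formal_frobenius[OF _ relative_closed_exact[OF assms(1,2)]] by metis
  \<comment> \<open>The bracket with \<open>C\<close> is
    \<open>g \<nabla>C \<cdot> (\<nabla>C \<times> \<nabla>F)\<close>, a triple product with a
    repeated factor.\<close>
  have "formal_casimir \<pi> C"
    by (simp add: formal_casimir_def bracket C[unfolded V] algebra_simps)
  moreover have "C \<notin> formal_constants"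
  proof
    assume "C \<in> formal_constants"
    then obtain c where "\<phi> = const3 c" using C(1) unfolding formal_constants_def by auto
    with isolated_singularity_gradient[OF assms(2)] show False by simp
  qed
  ultimately show ?thesis by blast
qed

end
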